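(* Let $n\in\mathbb{N}$, let $\phi=(\phi_1,\dots,\phi_n):U^n\to U^n$ be holomorphic, and let $p\ge 1$ and $q>0$. Consider the condition $$(\ast)\qquad \lim_{\phi(z)\to\partial U^n}\ \sum_{k,l=1}^n\left|\frac{\partial \phi_l}{\partial z_k}(z)\right|\frac{(1-|z_k|^2)^q}{(1-|\phi_l(z)|^2)^p}=0 .$$ Then the following statements are equivalent: (a) $C_\phi$ is a compact operator from $\mathcal{B}^p(U^n)$ to $\mathcal{B}^q(U^n)$ or from $\mathcal{B}^p_0(U^n)$ to $\mathcal{B}^q(U^n)$; (b) $(\ast)$ holds, and there is an $M\ge 0$ such that for all $z\in U^n$ $$\sum_{k,l=1}^n\left|\frac{\partial \phi_l}{\partial z_k}(z)\right|\frac{(1-|z_k|^2)^q}{(1-|\phi_l(z)|^2)^p}\le M;$$ (c) $\phi_l\in\mathcal{B}^q(U^n)$ for every $l\in\{1,2,\dots,n\}$, and $(\ast)$ holds.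
   Context: $U$ is the open unit disk in $\mathbb{C}$, $U^n\subset\mathbb{C}^n$ is the open unit polydisk, and $\partial U^n$ is its topological boundary. For a holomorphic self-map $\phi$ of $U^n$, the composition operator is $C_\phi f=f\circ\phi$ for $f$ holomorphic on $U^n$. For $p>0$, the $p$-Bloch space $\mathcal{B}^p(U^n)$ is the Banach space of holomorphic $f:U^n\to\mathbb{C}$ with finite norm $$\|f\|_{\mathcal{B}^p}=|f(0)|+\sup_{z\in U^n}\sum_{k=1}^n\left|\frac{\partial f}{\partial z_k}(z)\right|(1-|z_k|^2)^p .$$ The little $p$-Bloch space $\mathcal{B}^p_0(U^n)$ is the closure of the polynomials in $\mathcal{B}^p(U^n)$, with the same norm. The limit condition $\lim_{\phi(z)\to\partial U^n}S(z)=0$ means: for every $\varepsilon>0$ there is $\delta>0$ such that $|S(z)|<\varepsilon$ for all $z\in U^n$ whose image $\phi(z)$ has Euclidean distance less than $\delta$ to $\partial U^n$ (vacuously true if $\phi(U^n)$ stays away from $\partial U^n$). *)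

theory Defs
  imports "HOL-Analysis.Analysis"
begin

definition polydisk :: "(complex ^ 'n) set" where
  "polydisk = {z. \<forall>k. cmod (z $ k) < 1}"

definition holomorphic_cn :: "(complex ^ 'n \<Rightarrow> complex) \<Rightarrow> (complex ^ 'n) set \<Rightarrow> bool" where
  "holomorphic_cn f S \<longleftrightarrow>
     (\<forall>z\<in>S. \<exists>D. (f has_derivative D) (at z) \<and> (\<forall>c v. D (c *s v) = c * D v))"

definition cpartial :: "'n \<Rightarrow> (complex ^ 'n \<Rightarrow> complex) \<Rightarrow> complex ^ 'n \<Rightarrow> complex" where
  "cpartial k f z = deriv (\<lambda>w. f (\<chi> j. if j = k then w else z $ j)) (z $ k)"

definition bloch_seminorm_at :: "real \<Rightarrow> (complex ^ 'n \<Rightarrow> complex) \<Rightarrow> complex ^ 'n \<Rightarrow> real" where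
  "bloch_seminorm_at p f z = (\<Sum>k\<in>UNIV. cmod (cpartial k f z) * (1 - (cmod (z $ k))\<^sup>2) powr p)"

definition bloch_norm :: "real \<Rightarrow> (complex ^ 'n \<Rightarrow> complex) \<Rightarrow> real" where
  "bloch_norm p f = cmod (f 0) + (SUP z\<in>polydisk. bloch_seminorm_at p f z)"

text \<open>
  Functions on the polydisk are represented by extensional functions (undefined outside the
  polydisk), so that equality of elements is equality on the polydisk. The real supremum in the norm
  is meaningful only for bounded sets; the boundedness condition below says that the norm is
  finite.
\<close>

definition bloch :: "real \<Rightarrow> (complex ^ 'n \<Rightarrow> complex) set" where
  "bloch p = {f \<in> extensional polydisk. holomorphic_cn f polydisk \<and>
     bdd_above (bloch_seminorm_at p f ` polydisk)}"

text \<open>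
  The pointwise difference is not extensional, but the norm only sees values on the polydisk.
  The value 0 outside of the space is only there because the locale \<^locale>\<open>Metric_space\<close> requires
  nonnegativity and symmetry for all arguments.
\<close>

definition bloch_dist :: "real \<Rightarrow> (complex ^ 'n \<Rightarrow> complex) \<Rightarrow> (complex ^ 'n \<Rightarrow> complex) \<Rightarrow> real" where
  "bloch_dist p f g =
     (if f \<in> bloch p \<and> g \<in> bloch p then bloch_norm p (\<lambda>z. f z - g z) else 0)"

definition polynomial_cn :: "(complex ^ 'n \<Rightarrow> complex) \<Rightarrow> bool" where
  "polynomial_cn f \<longleftrightarrow> (\<exists>(A :: ('n \<Rightarrow> nat) set) c. finite A \<and>
     f = (\<lambda>z. \<Sum>\<alpha>\<in>A. c \<alpha> * (\<Prod>k\<in>UNIV. (z $ k) ^ \<alpha> k)))"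

definition little_bloch :: "real \<Rightarrow> (complex ^ 'n \<Rightarrow> complex) set" where
  "little_bloch p = Metric_space.mtopology (bloch p) (bloch_dist p) closure_of
     {restrict f polydisk | f. polynomial_cn f}"

text \<open>
  Bounded sets of the domain have relatively compact images in the codomain. Linearity is not
  part of the definition, as composition operators are always linear.
\<close>

definition compact_operator ::
  "'a set \<Rightarrow> ('a \<Rightarrow> 'a \<Rightarrow> real) \<Rightarrow> 'b set \<Rightarrow> ('b \<Rightarrow> 'b \<Rightarrow> real) \<Rightarrow> ('a \<Rightarrow> 'b) \<Rightarrow> bool" where
  "compact_operator X dX Y dY T \<longleftrightarrow> T ` X \<subseteq> Y \<and>
     (\<forall>B. Metric_space.mbounded X dX B \<longrightarrow>
        compactin (Metric_space.mtopology Y dY) (Metric_space.mtopology Y dY closure_of (T ` B)))"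

definition composition_op ::
  "(complex ^ 'n \<Rightarrow> complex ^ 'n) \<Rightarrow> (complex ^ 'n \<Rightarrow> complex) \<Rightarrow> complex ^ 'n \<Rightarrow> complex" where
  "composition_op \<phi> f = compose polydisk f \<phi>"

definition comp_weight_sum ::
  "real \<Rightarrow> real \<Rightarrow> (complex ^ 'n \<Rightarrow> complex ^ 'n) \<Rightarrow> complex ^ 'n \<Rightarrow> real" where
  "comp_weight_sum p q \<phi> z = (\<Sum>k\<in>UNIV. \<Sum>l\<in>UNIV. cmod (cpartial k (\<lambda>w. \<phi> w $ l) z) *
     ((1 - (cmod (z $ k))\<^sup>2) powr q / (1 - (cmod (\<phi> z $ l))\<^sup>2) powr p))"

definition vanishes_at_image_boundary ::
  "(complex ^ 'n \<Rightarrow> complex ^ 'n) \<Rightarrow> (complex ^ 'n \<Rightarrow> real) \<Rightarrow> bool" where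
  "vanishes_at_image_boundary \<phi> S \<longleftrightarrow> (\<forall>\<epsilon>>0. \<exists>\<delta>>0. \<forall>z\<in>polydisk.
     infdist (\<phi> z) (frontier polydisk) < \<delta> \<longrightarrow> \<bar>S z\<bar> < \<epsilon>)"

text \<open>The rest of this theory shows that the Bloch distance is indeed a metric, so that the
  topological notions above have their usual meaning.\<close>

lemma polydisk_open: "open (polydisk :: (complex ^ 'n) set)"
proof -
  have eq: "polydisk = (\<Inter>k. {z :: complex ^ 'n. cmod (z $ k) < 1})"
    by (auto simp: polydisk_def)
  have "open {z :: complex ^ 'n. cmod (z $ k) < 1}" for k
    by (intro open_Collect_less continuous_intros)
  then show ?thesis unfolding eq by (intro open_INT) auto
qed

lemma polydisk_convex: "convex (polydisk :: (complex ^ 'n) set)"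
proof -
  have eq: "polydisk = (\<Inter>k. (\<lambda>z :: complex ^ 'n. z $ k) -` ball 0 1)"
    by (auto simp: polydisk_def)
  have "convex ((\<lambda>z :: complex ^ 'n. z $ k) -` ball 0 1)" for k
    by (intro convex_linear_vimage convex_ball bounded_linear.linear bounded_linear_vec_nth)
  then show ?thesis unfolding eq by (intro convex_INT) auto
qed

lemma zero_in_polydisk: "0 \<in> polydisk"
  by (simp add: polydisk_def)

lemma ne_polydisk: "polydisk \<noteq> {}"
  using zero_in_polydisk by blast

lemma cpartial_eq:
  fixes f :: "complex ^ 'n \<Rightarrow> complex"
  assumes f: "(f has_derivative D) (at z)" and lin: "\<And>c v. D (c *s v) = c * D v"
  shows "((\<lambda>w. f (\<chi> j. if j = k then w else z $ j)) has_field_derivative D (axis k 1)) (at (z $ k))"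
    and "cpartial k f z = D (axis k 1)"
proof -
  let ?h = "\<lambda>w. z + (w - z $ k) *s axis k 1"
  have eq: "(\<chi> j. if j = k then w else z $ j) = ?h w" for w
    by (auto simp: vec_eq_iff axis_def)
  have "bounded_linear (\<lambda>w. w *s axis k 1 :: complex ^ 'n)"
    by (intro linear_conv_bounded_linear[THEN iffD1] linearI)
       (auto simp: vec_eq_iff algebra_simps)
  then have "((\<lambda>w. (w - z $ k) *s axis k 1 :: complex ^ 'n) has_derivative (\<lambda>w. w *s axis k 1)) (at (z $ k))"
    by (rule bounded_linear.has_derivative) (auto intro!: derivative_eq_intros)
  then have h: "(?h has_derivative (\<lambda>w. w *s axis k 1)) (at (z $ k))"
    by (rule has_derivative_add[OF has_derivative_const, THEN has_derivative_eq_rhs]) simp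
  have "(f has_derivative D) (at (?h (z $ k)))"
    using f by simp
  from diff_chain_at[OF h this]
  have "((\<lambda>w. f (?h w)) has_derivative (\<lambda>w. D (w *s axis k 1))) (at (z $ k))"
    by (simp add: o_def)
  then show *: "((\<lambda>w. f (\<chi> j. if j = k then w else z $ j)) has_field_derivative D (axis k 1)) (at (z $ k))"
    unfolding has_field_derivative_def eq lin
    by (rule has_derivative_eq_rhs) (simp add: fun_eq_iff mult.commute)
  show "cpartial k f z = D (axis k 1)"
    unfolding cpartial_def by (rule DERIV_imp_deriv[OF *])
qed

lemma holomorphic_cn_diff:
  assumes "holomorphic_cn f S" "holomorphic_cn g S"
  shows "holomorphic_cn (\<lambda>z. f z - g z) S"
    and "z \<in> S \<Longrightarrow> cpartial k (\<lambda>z. f z - g z) z = cpartial k f z - cpartial k g z"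
proof -
  have *: "\<exists>D. ((\<lambda>z. f z - g z) has_derivative D) (at z) \<and> (\<forall>c v. D (c *s v) = c * D v) \<and>
    (\<forall>k. cpartial k (\<lambda>z. f z - g z) z = cpartial k f z - cpartial k g z)" if "z \<in> S" for z
  proof -
    obtain D where D: "(f has_derivative D) (at z)" "\<And>c v. D (c *s v) = c * D v"
      using assms(1) \<open>z \<in> S\<close> unfolding holomorphic_cn_def by blast
    obtain E where E: "(g has_derivative E) (at z)" "\<And>c v. E (c *s v) = c * E v"
      using assms(2) \<open>z \<in> S\<close> unfolding holomorphic_cn_def by blast
    have F: "((\<lambda>z. f z - g z) has_derivative (\<lambda>v. D v - E v)) (at z)"
      using D(1) E(1) by (rule has_derivative_diff)
    have lin: "D (c *s v) - E (c *s v) = c * (D v - E v)" for c v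
      by (simp add: D E algebra_simps)
    show ?thesis
      using F lin cpartial_eq(2)[OF D] cpartial_eq(2)[OF E] cpartial_eq(2)[OF F lin] by auto
  qed
  show "holomorphic_cn (\<lambda>z. f z - g z) S"
    unfolding holomorphic_cn_def using * by blast
  show "cpartial k (\<lambda>z. f z - g z) z = cpartial k f z - cpartial k g z" if "z \<in> S"
    using *[OF that] by blast
qed

lemma bloch_seminorm_at_nonneg: "0 \<le> bloch_seminorm_at p f z"
  by (simp add: bloch_seminorm_at_def sum_nonneg)

lemma bloch_seminorm_at_triangle:
  assumes "\<And>k. cpartial k h z = cpartial k f z - cpartial k g z"
  shows "bloch_seminorm_at p h z \<le> bloch_seminorm_at p f z + bloch_seminorm_at p g z"
  unfolding bloch_seminorm_at_def sum.distrib[symmetric] assms distrib_right[symmetric]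
  by (intro sum_mono mult_right_mono norm_triangle_ineq4) auto

lemma bloch_diff:
  assumes f: "f \<in> bloch p" and g: "g \<in> bloch p"
  shows "holomorphic_cn (\<lambda>z. f z - g z) polydisk"
    and "bdd_above (bloch_seminorm_at p (\<lambda>z. f z - g z) ` polydisk)"
proof -
  have h: "holomorphic_cn f polydisk" "holomorphic_cn g polydisk"
    using f g by (auto simp: bloch_def)
  show "holomorphic_cn (\<lambda>z. f z - g z) polydisk"
    by (rule holomorphic_cn_diff(1)[OF h])
  obtain A where A: "\<And>z. z \<in> polydisk \<Longrightarrow> bloch_seminorm_at p f z \<le> A"
    using f by (auto simp: bloch_def bdd_above_def)
  obtain B where B: "\<And>z. z \<in> polydisk \<Longrightarrow> bloch_seminorm_at p g z \<le> B"
    using g by (auto simp: bloch_def bdd_above_def)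
  show "bdd_above (bloch_seminorm_at p (\<lambda>z. f z - g z) ` polydisk)"
  proof (rule bdd_aboveI2)
    fix z :: "complex ^ 'a" assume z: "z \<in> polydisk"
    show "bloch_seminorm_at p (\<lambda>z. f z - g z) z \<le> A + B"
      using bloch_seminorm_at_triangle[OF holomorphic_cn_diff(2)[OF h z], of p] A[OF z] B[OF z]
      by linarith
  qed
qed

lemma bloch_norm_seminorm_nonneg:
  assumes "bdd_above (bloch_seminorm_at p f ` polydisk)"
  shows "0 \<le> (SUP z\<in>polydisk. bloch_seminorm_at p f z)"
  using cSUP_upper2[OF assms zero_in_polydisk bloch_seminorm_at_nonneg] .

lemma bloch_norm_eq_0:
  fixes f :: "complex ^ 'n \<Rightarrow> complex"
  assumes hol: "holomorphic_cn f polydisk" and bdd: "bdd_above (bloch_seminorm_at p f ` polydisk)"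
    and 0: "bloch_norm p f = 0" and z: "z \<in> polydisk"
  shows "f z = 0"
proof -
  have f0: "f 0 = 0" and sup: "(SUP z\<in>polydisk. bloch_seminorm_at p f z) = 0"
    using 0 bloch_norm_seminorm_nonneg[OF bdd] norm_ge_zero[of "f 0"]
    unfolding bloch_norm_def by (auto simp: add_nonneg_eq_0_iff)
  have "(f has_derivative (\<lambda>_. 0)) (at w within polydisk)" if w: "w \<in> polydisk" for w
  proof -
    obtain D where D: "(f has_derivative D) (at w)" "\<And>c v. D (c *s v) = c * D v"
      using hol w unfolding holomorphic_cn_def by blast
    have "bloch_seminorm_at p f w = 0"
      using cSUP_upper[OF w bdd] sup bloch_seminorm_at_nonneg[of p f w] by simp
    then have "cmod (cpartial k f w) * (1 - (cmod (w $ k))\<^sup>2) powr p = 0" for k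
      unfolding bloch_seminorm_at_def by (subst (asm) sum_nonneg_eq_0_iff) auto
    moreover have "(1 - (cmod (w $ k))\<^sup>2) powr p \<noteq> 0" for k
    proof -
      have "(cmod (w $ k))\<^sup>2 < 1"
        using w by (simp add: polydisk_def abs_square_less_1)
      then show ?thesis by simp
    qed
    ultimately have c: "D (axis k 1) = 0" for k
      using cpartial_eq(2)[OF D, of k] by auto
    have "D v = 0" for v
    proof -
      have "v = (\<Sum>k\<in>UNIV. (v $ k) *s axis k 1)"
        by (simp add: basis_expansion)
      then have "D v = (\<Sum>k\<in>UNIV. D ((v $ k) *s axis k 1))"
        using linear_sum[OF has_derivative_linear[OF D(1)]] by metis
      then show ?thesis by (simp add: D(2) c)
    qed
    then have "D = (\<lambda>_. 0)" by auto
    then show ?thesis using D(1) has_derivative_at_withinI by blast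
  qed
  then obtain c where "\<And>w. w \<in> polydisk \<Longrightarrow> f w = c"
    using has_derivative_zero_constant[OF polydisk_convex] by metis
  then show ?thesis using f0 z zero_in_polydisk by metis
qed

lemma Metric_space_bloch:
  "Metric_space (bloch p :: (complex ^ 'n \<Rightarrow> complex) set) (bloch_dist p)"
proof (rule Metric_space.intro)
  fix f g :: "complex ^ 'n \<Rightarrow> complex"
  show "0 \<le> bloch_dist p f g"
    using bloch_norm_seminorm_nonneg[OF bloch_diff(2), of f p g]
    unfolding bloch_dist_def bloch_norm_def by auto
next
  fix f g :: "complex ^ 'n \<Rightarrow> complex"
  have "bloch_norm p (\<lambda>z. f z - g z) = bloch_norm p (\<lambda>z. g z - f z)"
    if "f \<in> bloch p" "g \<in> bloch p"
  proof -
    have h: "holomorphic_cn f polydisk" "holomorphic_cn g polydisk"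
      using that by (auto simp: bloch_def)
    have "bloch_seminorm_at p (\<lambda>z. f z - g z) z = bloch_seminorm_at p (\<lambda>z. g z - f z) z"
      if "z \<in> polydisk" for z
      unfolding bloch_seminorm_at_def
      by (simp add: holomorphic_cn_diff(2)[OF h that]
            holomorphic_cn_diff(2)[OF h(2) h(1) that] norm_minus_commute)
    then show ?thesis
      unfolding bloch_norm_def by (simp add: norm_minus_commute cong: SUP_cong)
  qed
  then show "bloch_dist p f g = bloch_dist p g f"
    by (auto simp: bloch_dist_def)
next
  fix f g :: "complex ^ 'n \<Rightarrow> complex"
  assume f: "f \<in> bloch p" and g: "g \<in> bloch p"
  show "bloch_dist p f g = 0 \<longleftrightarrow> f = g"
  proof
    assume "bloch_dist p f g = 0"
    then have "bloch_norm p (\<lambda>z. f z - g z) = 0"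
      using f g by (simp add: bloch_dist_def)
    from bloch_norm_eq_0[OF bloch_diff[OF f g] this]
    have "f z = g z" if "z \<in> polydisk" for z using that by fastforce
    then show "f = g"
      using f g by (intro extensionalityI[of _ polydisk]) (auto simp: bloch_def)
  next
    assume "f = g"
    have "(SUP z\<in>(polydisk :: (complex ^ 'n) set). 0 :: real) = 0"
      by (rule cSUP_const[OF ne_polydisk])
    with \<open>f = g\<close> show "bloch_dist p f g = 0"
      by (simp add: bloch_dist_def bloch_norm_def bloch_seminorm_at_def cpartial_def)
  qed
next
  fix f g h :: "complex ^ 'n \<Rightarrow> complex"
  assume f: "f \<in> bloch p" and g: "g \<in> bloch p" and h: "h \<in> bloch p"
  have hol: "holomorphic_cn f polydisk" "holomorphic_cn g polydisk" "holomorphic_cn h polydisk"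
    using f g h by (auto simp: bloch_def)
  let ?s = "\<lambda>f g. bloch_seminorm_at p (\<lambda>z. f z - g z)"
  have "(SUP z\<in>polydisk. ?s f h z) \<le> (SUP z\<in>polydisk. ?s f g z) + (SUP z\<in>polydisk. ?s g h z)"
  proof (rule cSUP_least)
    show "polydisk \<noteq> ({} :: (complex ^ 'n) set)" by (rule ne_polydisk)
  next
    fix z :: "complex ^ 'n" assume z: "z \<in> polydisk"
    have tri: "cmod (a - c) \<le> cmod (a - b) + cmod (b - c)" for a b c
      by (rule norm_diff_triangle_le) (rule order_refl)+
    have "?s f h z \<le> ?s f g z + ?s g h z"
      unfolding bloch_seminorm_at_def sum.distrib[symmetric] distrib_right[symmetric]
      by (intro sum_mono mult_right_mono)
         (simp_all add: holomorphic_cn_diff(2)[OF hol(1,3) z] holomorphic_cn_diff(2)[OF hol(1,2) z]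
            holomorphic_cn_diff(2)[OF hol(2,3) z] tri)
    also have "\<dots> \<le> (SUP z\<in>polydisk. ?s f g z) + (SUP z\<in>polydisk. ?s g h z)"
      by (intro add_mono cSUP_upper z bloch_diff f g h)
    finally show "?s f h z \<le> \<dots>" .
  qed
  moreover have "cmod (f 0 - h 0) \<le> cmod (f 0 - g 0) + cmod (g 0 - h 0)"
    by (rule norm_diff_triangle_le) (rule order_refl)+
  ultimately show "bloch_dist p f h \<le> bloch_dist p f g + bloch_dist p g h"
    using f g h by (simp add: bloch_dist_def bloch_norm_def)
qed

end

theory Submission
  imports Defs "HOL-Complex_Analysis.Great_Picard"
begin

text \<open>
  Sufficiency. A sequence that is bounded in the \<open>p\<close>-Bloch norm has, by Arzela-Ascoli and Cauchy's
  estimates, a subsequence \<open>f\<^sub>j\<close> converging locally uniformly together with its partial derivatives to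
  some \<open>g\<close> with the same bounds. The seminorm of \<open>(f\<^sub>j - g) \<circ> \<phi>\<close> is small where \<open>\<phi>(z)\<close> is near the
  boundary, because there the weight sum is small and \<open>f\<^sub>j - g\<close> is bounded, and it is small elsewhere,
  because there \<open>\<phi>(z)\<close> stays in a compact set and the weight sum is bounded.

  Necessity. Compactness on the little Bloch space forces \<open>\<parallel>F\<^sub>N \<circ> \<phi>\<parallel> \<longrightarrow> 0\<close> for every bounded sequence of
  polynomials that tends to 0 pointwise. The polynomials \<open>N\<^bsup>p-1\<^esup> w\<^sub>l\<^sup>N\<close> with \<open>N\<close> close to
  \<open>1 / (1 - \<bar>\<phi>\<^sub>l(z)\<bar>)\<close> show that the \<open>l\<close>-th part of the weight sum tends to 0 as \<open>\<bar>\<phi>\<^sub>l(z)\<bar> \<longrightarrow> 1\<close>. When instead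
  another component \<open>\<phi>\<^sub>m(z)\<close> tends to the unit circle, the polynomials \<open>w\<^sub>m\<^sup>N w\<^sub>l\<close>, which are bounded because
  \<open>p \<ge> 1\<close>, show that the \<open>l\<close>-th part still tends to 0.
\<close>

subsection \<open>Holomorphic functions of several variables\<close>

text \<open>A complex-linear derivative is determined by its values on the unit vectors
  \<open>axis k 1\<close>, and these values are the partial derivatives.\<close>

lemma holomorphic_cn_has_derivative:
  fixes f :: "complex ^ 'n \<Rightarrow> complex"
  assumes "holomorphic_cn f S" "z \<in> S"
  shows "(f has_derivative (\<lambda>v. \<Sum>k\<in>UNIV. cpartial k f z * v $ k)) (at z)"
proof -
  obtain D where D: "(f has_derivative D) (at z)" "\<And>c v. D (c *s v) = c * D v"
    using assms unfolding holomorphic_cn_def by blast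
  have "D v = (\<Sum>k\<in>UNIV. cpartial k f z * v $ k)" for v
  proof -
    have "v = (\<Sum>k\<in>UNIV. (v $ k) *s axis k 1)"
      by (simp add: basis_expansion)
    then have "D v = (\<Sum>k\<in>UNIV. D ((v $ k) *s axis k 1))"
      using linear_sum[OF has_derivative_linear[OF D(1)]] by metis
    then show ?thesis
      by (simp add: D(2) cpartial_eq(2)[OF D] mult.commute)
  qed
  then have "D = (\<lambda>v. \<Sum>k\<in>UNIV. cpartial k f z * v $ k)" by auto
  with D(1) show ?thesis by simp
qed

text \<open>Used to read off the partial derivatives once a derivative is known in coordinate form,
  in particular after the chain rule and after a passage to the limit.\<close>

lemma cpartial_eqI:
  fixes f :: "complex ^ 'n \<Rightarrow> complex"
  assumes "(f has_derivative (\<lambda>v. \<Sum>k\<in>UNIV. c k * v $ k)) (at z)"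
  shows "cpartial k f z = c k"
proof -
  have "cpartial k f z = (\<Sum>j\<in>UNIV. c j * axis k 1 $ j)"
    by (rule cpartial_eq(2)[OF assms]) (simp add: sum_distrib_left mult.left_commute)
  also have "\<dots> = (\<Sum>j\<in>UNIV. if j = k then c j else 0)"
    by (intro sum.cong) (auto simp: axis_def)
  finally show ?thesis by simp
qed

lemma holomorphic_cnI:
  assumes "\<And>z. z \<in> S \<Longrightarrow> (f has_derivative (\<lambda>v. \<Sum>k\<in>UNIV. c z k * v $ k)) (at z)"
  shows "holomorphic_cn f S"
  unfolding holomorphic_cn_def
proof
  fix z assume "z \<in> S"
  from assms[OF this] show "\<exists>D. (f has_derivative D) (at z) \<and> (\<forall>c v. D (c *s v) = c * D v)"
    by (intro exI conjI) (auto simp: sum_distrib_left mult.left_commute)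
qed

text \<open>Elements of \<open>bloch p\<close> are extensional, so functions are constantly
  exchanged with their restrictions; on an open set this changes no derivative.\<close>

lemma holomorphic_cn_transform:
  assumes f: "holomorphic_cn f S" and "open S" and eq: "\<And>z. z \<in> S \<Longrightarrow> f z = g z"
  shows "holomorphic_cn g S" and "z \<in> S \<Longrightarrow> cpartial k g z = cpartial k f z"
proof -
  have D: "(g has_derivative (\<lambda>v. \<Sum>k\<in>UNIV. cpartial k f z * v $ k)) (at z)" if "z \<in> S" for z
    using has_derivative_transform_within_open[OF holomorphic_cn_has_derivative[OF f that] \<open>open S\<close> that]
      eq by blast
  show "holomorphic_cn g S"
    using D by (rule holomorphic_cnI)
  show "cpartial k g z = cpartial k f z" if "z \<in> S"
    by (rule cpartial_eqI[OF D[OF that]])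
qed

text \<open>The chain rule. Holomorphy is only defined for scalar functions, so the derivative of
  \<open>\<phi>\<close> is first assembled from those of its components.\<close>

lemma holomorphic_cn_compose_has_derivative:
  fixes f :: "complex ^ 'm \<Rightarrow> complex" and \<phi> :: "complex ^ 'n \<Rightarrow> complex ^ 'm"
  assumes f: "holomorphic_cn f T" and \<phi>: "\<And>l. holomorphic_cn (\<lambda>z. \<phi> z $ l) S"
    and im: "\<phi> ` S \<subseteq> T" and z: "z \<in> S"
  shows "((\<lambda>z. f (\<phi> z)) has_derivative (\<lambda>v. \<Sum>k\<in>UNIV.
    (\<Sum>l\<in>UNIV. cpartial l f (\<phi> z) * cpartial k (\<lambda>z. \<phi> z $ l) z) * v $ k)) (at z)"
proof -
  let ?D = "\<lambda>v. \<chi> l. \<Sum>k\<in>UNIV. cpartial k (\<lambda>z. \<phi> z $ l) z * v $ k"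
  have "(\<phi> has_derivative ?D) (at z)"
    unfolding has_derivative_componentwise_within[of \<phi>]
  proof
    fix i :: "complex ^ 'm" assume "i \<in> Basis"
    \<comment> \<open>The real basis consists of the vectors \<open>axis l u\<close> with
      \<open>u\<close> in the real basis of the complex numbers; the inner product with one of them
      is a real functional of the \<open>l\<close>-th component.\<close>
    then obtain l u where i: "i = axis l u" by (auto simp: Basis_vec_def)
    have "((\<lambda>z. \<phi> z $ l \<bullet> u) has_derivative (\<lambda>v. ?D v $ l \<bullet> u)) (at z)"
      using has_derivative_inner_left[OF holomorphic_cn_has_derivative[OF \<phi>[of l] z], of u] by simp
    then show "((\<lambda>x. \<phi> x \<bullet> i) has_derivative (\<lambda>x. ?D x \<bullet> i)) (at z)"
      unfolding i inner_axis .
  qed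
  moreover have "(f has_derivative (\<lambda>v. \<Sum>l\<in>UNIV. cpartial l f (\<phi> z) * v $ l)) (at (\<phi> z))"
    using holomorphic_cn_has_derivative[OF f] im z by blast
  ultimately have "((\<lambda>z. f (\<phi> z)) has_derivative
      (\<lambda>v. \<Sum>l\<in>UNIV. cpartial l f (\<phi> z) * ?D v $ l)) (at z)"
    using diff_chain_at by (fastforce simp: o_def)
  moreover have "(\<Sum>l\<in>UNIV. cpartial l f (\<phi> z) * ?D v $ l) = (\<Sum>k\<in>UNIV.
    (\<Sum>l\<in>UNIV. cpartial l f (\<phi> z) * cpartial k (\<lambda>z. \<phi> z $ l) z) * v $ k)" for v
    unfolding vec_lambda_beta sum_distrib_left sum_distrib_right
    by (subst sum.swap) (simp add: mult.assoc)
  ultimately show ?thesis by simp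
qed

subsection \<open>Closed polydisks and Cauchy estimates\<close>

lemma polydisk_one_minus_sq:
  assumes "z \<in> polydisk"
  shows "0 < 1 - (cmod (z $ k))\<^sup>2" "1 - (cmod (z $ k))\<^sup>2 \<le> 1"
  using assms by (auto simp: polydisk_def abs_square_less_1)

text \<open>For \<open>r < 1\<close> these compact convex sets exhaust the polydisk, and locally
  uniform convergence means uniform convergence on each of them. For negative \<open>r\<close> the
  set is empty.\<close>

definition closed_polydisk :: "real \<Rightarrow> (complex ^ 'n) set" where
  "closed_polydisk r = {z. \<forall>k. cmod (z $ k) \<le> r}"

lemma closed_polydisk_subset: "r < 1 \<Longrightarrow> closed_polydisk r \<subseteq> polydisk"
  by (auto simp: closed_polydisk_def polydisk_def intro: le_less_trans)

lemma closed_polydisk_mono: "r \<le> s \<Longrightarrow> closed_polydisk r \<subseteq> closed_polydisk s"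
  by (auto simp: closed_polydisk_def intro: order_trans)

lemma closed_polydisk_eq_INT: "closed_polydisk r = (\<Inter>k. (\<lambda>z :: complex ^ 'n. z $ k) -` cball 0 r)"
  by (auto simp: closed_polydisk_def)

lemma convex_closed_polydisk: "convex (closed_polydisk r)"
  unfolding closed_polydisk_eq_INT
  by (intro convex_INT convex_linear_vimage convex_cball bounded_linear.linear bounded_linear_vec_nth)

lemma compact_closed_polydisk: "compact (closed_polydisk r :: (complex ^ 'n) set)"
proof -
  have "bounded (closed_polydisk r :: (complex ^ 'n) set)"
  proof (rule boundedI)
    fix z :: "complex ^ 'n" assume "z \<in> closed_polydisk r"
    then have "(\<Sum>k\<in>UNIV. cmod (z $ k)) \<le> (\<Sum>k\<in>(UNIV :: 'n set). r)"
      by (intro sum_mono) (simp add: closed_polydisk_def)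
    then show "norm z \<le> (\<Sum>k\<in>(UNIV :: 'n set). r)"
      unfolding norm_vec_def by (rule order_trans[OF L2_set_le_sum, rotated]) simp
  qed
  moreover have "closed (closed_polydisk r :: (complex ^ 'n) set)"
    unfolding closed_polydisk_eq_INT
    by (intro closed_INT ballI continuous_closed_vimage closed_cball continuous_intros)
  ultimately show ?thesis by (simp add: compact_eq_bounded_closed)
qed

lemma polydisk_in_closed_polydisk:
  fixes z :: "complex ^ 'n"
  assumes "z \<in> polydisk"
  obtains r where "0 \<le> r" "r < 1" "z \<in> closed_polydisk r"
proof
  \<comment> \<open>There are finitely many coordinates, so the largest modulus is attained and
    stays below 1.\<close>
  let ?r = "Max (range (\<lambda>k. cmod (z $ k)))"
  show "z \<in> closed_polydisk ?r"
    by (auto simp: closed_polydisk_def)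
  show "?r < 1"
    using assms by (simp add: polydisk_def)
  show "0 \<le> ?r"
    by (meson Max_ge finite finite_imageI norm_ge_zero order_trans rangeI)
qed

text \<open>On the closed polydisk of radius \<open>r\<close> every weight is at least
  \<open>(1 - r\<^sup>2) powr p\<close>.\<close>

lemma cpartial_le_seminorm:
  assumes z: "z \<in> closed_polydisk r" and r: "r < 1" "0 \<le> r" and p: "0 \<le> p"
    and A: "bloch_seminorm_at p f z \<le> A"
  shows "(\<Sum>k\<in>UNIV. cmod (cpartial k f z)) \<le> A / (1 - r\<^sup>2) powr p"
proof -
  have r2: "0 < 1 - r\<^sup>2" using r by (simp add: abs_square_less_1)
  have "(\<Sum>k\<in>UNIV. cmod (cpartial k f z)) * (1 - r\<^sup>2) powr p \<le> bloch_seminorm_at p f z"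
    unfolding bloch_seminorm_at_def sum_distrib_right
  proof (intro sum_mono mult_left_mono powr_mono2 p)
    fix k
    have "cmod (z $ k) \<le> r" using z by (simp add: closed_polydisk_def)
    then show "1 - r\<^sup>2 \<le> 1 - (cmod (z $ k))\<^sup>2" by (simp add: power_mono)
  qed (use r2 in auto)
  with A show ?thesis using r2 by (simp add: pos_le_divide_eq)
qed

text \<open>The mean value inequality on a convex set. The constant depends on \<open>f\<close> only
  through \<open>A\<close>, which gives equicontinuity of bounded families and, with
  \<open>y = 0\<close>, bounds for point evaluations.\<close>

lemma bloch_lipschitz:
  fixes f :: "complex ^ 'n \<Rightarrow> complex"
  assumes f: "holomorphic_cn f polydisk" and A: "\<And>z. z \<in> polydisk \<Longrightarrow> bloch_seminorm_at p f z \<le> A"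
    and r: "r < 1" "0 \<le> r" and p: "0 \<le> p"
    and xy: "x \<in> closed_polydisk r" "y \<in> closed_polydisk r"
  shows "cmod (f x - f y) \<le> A / (1 - r\<^sup>2) powr p * norm (x - y)"
proof (rule differentiable_bound[OF convex_closed_polydisk _ _ xy])
  fix z assume z: "z \<in> (closed_polydisk r :: (complex ^ 'n) set)"
  then have zp: "z \<in> polydisk" using closed_polydisk_subset r by blast
  show "(f has_derivative (\<lambda>v. \<Sum>k\<in>UNIV. cpartial k f z * v $ k)) (at z within closed_polydisk r)"
    by (rule has_derivative_at_withinI[OF holomorphic_cn_has_derivative[OF f zp]])
  show "onorm (\<lambda>v. \<Sum>k\<in>UNIV. cpartial k f z * v $ k) \<le> A / (1 - r\<^sup>2) powr p"
  proof (rule onorm_le)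
    fix v :: "complex ^ 'n"
    have "cmod (\<Sum>k\<in>UNIV. cpartial k f z * v $ k) \<le> (\<Sum>k\<in>UNIV. cmod (cpartial k f z)) * norm v"
      unfolding sum_distrib_right
      by (rule sum_norm_le) (simp add: norm_mult mult_left_mono Finite_Cartesian_Product.norm_nth_le)
    also have "\<dots> \<le> A / (1 - r\<^sup>2) powr p * norm v"
      by (intro mult_right_mono cpartial_le_seminorm[OF z r p A[OF zp]]) auto
    finally show "cmod (\<Sum>k\<in>UNIV. cpartial k f z * v $ k) \<le> A / (1 - r\<^sup>2) powr p * norm v" .
  qed
qed

text \<open>The Cauchy inequality in the \<open>k\<close>-th variable alone: the disc of radius
  \<open>R - r\<close> about \<open>z $ k\<close>, with the other coordinates fixed, stays in the
  larger closed polydisk.\<close>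

lemma cpartial_Cauchy_bound:
  fixes f :: "complex ^ 'n \<Rightarrow> complex"
  assumes f: "holomorphic_cn f polydisk" and rR: "r < R" "R < 1" and z: "z \<in> closed_polydisk r"
    and B: "\<And>w. w \<in> closed_polydisk R \<Longrightarrow> cmod (f w) \<le> B"
  shows "cmod (cpartial k f z) \<le> B / (R - r)"
proof -
  let ?u = "\<lambda>w. \<chi> j. if j = k then w else z $ j"
  let ?g = "\<lambda>w. f (?u w)"
  have in_R: "?u w \<in> closed_polydisk R" if "w \<in> cball (z $ k) (R - r)" for w
  proof -
    have "cmod w \<le> cmod (z $ k) + cmod (z $ k - w)"
      by (metis norm_triangle_sub add.commute norm_minus_commute)
    also have "\<dots> \<le> r + (R - r)"
      using that z by (intro add_mono) (auto simp: closed_polydisk_def dist_norm)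
    finally have "cmod w \<le> R" by simp
    moreover have "cmod (z $ j) \<le> R" for j
      using z rR by (force simp: closed_polydisk_def intro: order_trans less_imp_le)
    ultimately show ?thesis by (simp add: closed_polydisk_def)
  qed
  have fd: "?g field_differentiable (at w)" if "w \<in> cball (z $ k) (R - r)" for w
  proof -
    have "?u w \<in> polydisk" using in_R[OF that] closed_polydisk_subset rR by blast
    then obtain D where D: "(f has_derivative D) (at (?u w))" "\<And>c v. D (c *s v) = c * D v"
      using f unfolding holomorphic_cn_def by blast
    have "(\<lambda>x. f (\<chi> j. if j = k then x else ?u w $ j)) = ?g"
      by (rule ext, rule arg_cong[where f = f]) (auto simp: vec_eq_iff)
    with cpartial_eq(1)[OF D, of k] show ?thesis
      unfolding field_differentiable_def by auto
  qed
  have "cmod ((deriv ^^ 1) ?g (z $ k)) \<le> fact 1 * B / (R - r) ^ 1"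
  proof (rule Cauchy_inequality)
    show "?g holomorphic_on ball (z $ k) (R - r)"
      unfolding holomorphic_on_def by (rule ballI, rule field_differentiable_at_within, rule fd) simp
    show "continuous_on (cball (z $ k) (R - r)) ?g"
      by (rule continuous_at_imp_continuous_on, rule ballI,
          rule field_differentiable_imp_continuous_at, rule fd)
    show "cmod (?g x) \<le> B" if "cmod (z $ k - x) = R - r" for x
      by (rule B[OF in_R]) (use that in \<open>simp add: dist_norm\<close>)
  qed (use rR in simp)
  then show ?thesis by (simp add: cpartial_def)
qed

subsection \<open>A Montel theorem for Bloch functions\<close>

text \<open>Arzela-Ascoli on each set of an exhaustion, followed by a diagonal argument. The
  conclusion is a Cauchy property because the limits on the different sets then need not be
  glued.\<close>

lemma bloch_locally_uniform_subsequence: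
  fixes f :: "nat \<Rightarrow> complex ^ 'n \<Rightarrow> complex"
  assumes f: "\<And>j. holomorphic_cn (f j) polydisk"
    and A: "\<And>j z. z \<in> polydisk \<Longrightarrow> bloch_seminorm_at p (f j) z \<le> A"
    and f0: "\<And>j. cmod (f j 0) \<le> A" and p: "0 \<le> p"
  obtains \<rho> :: "nat \<Rightarrow> nat" where "strict_mono \<rho>"
    "\<And>r. r < 1 \<Longrightarrow> uniformly_Cauchy_on (closed_polydisk r) (\<lambda>j. f (\<rho> j))"
proof -
  \<comment> \<open>Radii increasing to 1; the summand 2 keeps them nonnegative from the
    start.\<close>
  define r :: "nat \<Rightarrow> real" where "r i = 1 - 1 / (real i + 2)" for i
  have r: "0 \<le> r i" "r i < 1" for i
    by (auto simp: r_def field_simps)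
  have A0: "0 \<le> A"
    using f0[of 0] norm_ge_zero order_trans by blast
  let ?P = "\<lambda>i (\<rho> :: nat \<Rightarrow> nat). uniformly_Cauchy_on (closed_polydisk (r i)) (\<lambda>j. f (\<rho> j))"
  obtain \<rho> :: "nat \<Rightarrow> nat" where \<rho>: "strict_mono \<rho>" "\<And>i. ?P i (id \<circ> \<rho>)"
  proof (rule subsequence_diagonalization_lemma[of ?P id])
    fix i and \<rho> :: "nat \<Rightarrow> nat"
    let ?K = "closed_polydisk (r i) :: (complex ^ 'n) set"
    define L where "L = A / (1 - (r i)\<^sup>2) powr p"
    have L: "cmod (f j x - f j y) \<le> L * norm (x - y)" if "x \<in> ?K" "y \<in> ?K" for j x y
      unfolding L_def using that r by (intro bloch_lipschitz f A p) auto
    have L0: "0 \<le> L" using A0 by (simp add: L_def)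
    have "bounded ?K" using compact_closed_polydisk compact_imp_bounded by blast
    then obtain b where b: "\<And>x. x \<in> ?K \<Longrightarrow> norm x \<le> b" by (auto simp: bounded_iff)
    \<comment> \<open>The bound at the origin spreads over \<open>?K\<close> by the Lipschitz
      estimate.\<close>
    have zero: "0 \<in> ?K" using r by (simp add: closed_polydisk_def)
    obtain g k where "strict_mono (k :: nat \<Rightarrow> nat)"
      and g: "\<And>e. 0 < e \<Longrightarrow> \<exists>N. \<forall>n x. n \<ge> N \<and> x \<in> ?K \<longrightarrow> norm (f (\<rho> (k n)) x - g x) < e"
    proof (rule Arzela_Ascoli[OF compact_closed_polydisk, of "r i" "\<lambda>n. f (\<rho> n)" "A + L * b"])
      fix n x assume x: "x \<in> ?K"
      have "cmod (f (\<rho> n) x) \<le> cmod (f (\<rho> n) 0) + cmod (f (\<rho> n) x - f (\<rho> n) 0)"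
        using norm_triangle_ineq[of "f (\<rho> n) 0" "f (\<rho> n) x - f (\<rho> n) 0"] by simp
      also have "\<dots> \<le> A + L * norm (x - 0)"
        by (intro add_mono f0 L x zero)
      also have "\<dots> \<le> A + L * b"
        using b[OF x] L0 by (simp add: mult_left_mono)
      finally show "cmod (f (\<rho> n) x) \<le> A + L * b" .
    next
      fix x and e :: real assume x: "x \<in> ?K" and e: "0 < e"
      show "\<exists>d>0. \<forall>n y. y \<in> ?K \<and> norm (x - y) < d \<longrightarrow> cmod (f (\<rho> n) x - f (\<rho> n) y) < e"
      proof (intro exI conjI allI impI)
        \<comment> \<open>\<open>L + 1\<close> replaces \<open>L\<close> because \<open>L\<close>
          may vanish.\<close>
        show "0 < e / (L + 1)" using e L0 by simp
        fix n y assume y: "y \<in> ?K \<and> norm (x - y) < e / (L + 1)"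
        have "cmod (f (\<rho> n) x - f (\<rho> n) y) \<le> L * norm (x - y)" using L x y by blast
        also have "\<dots> \<le> (L + 1) * norm (x - y)" by (simp add: algebra_simps)
        also have "\<dots> < e" using y L0 by (simp add: pos_less_divide_eq mult.commute)
        finally show "cmod (f (\<rho> n) x - f (\<rho> n) y) < e" .
      qed
    qed blast
    have "uniform_limit ?K (\<lambda>n. f ((\<rho> \<circ> k) n)) g sequentially"
      unfolding uniform_limit_sequentially_iff
    proof (intro allI impI)
      fix e :: real assume "0 < e"
      from g[OF this] show "\<exists>N. \<forall>n\<ge>N. \<forall>x\<in>?K. dist (f ((\<rho> \<circ> k) n) x) (g x) < e"
        by (simp add: dist_norm) blast
    qed
    then have "?P i (\<rho> \<circ> k)"
      by (intro uniformly_convergent_Cauchy uniformly_convergentI)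
    with \<open>strict_mono k\<close> show "\<exists>k. strict_mono k \<and> ?P i (\<rho> \<circ> k)" by blast
  next
    \<comment> \<open>The second condition of the diagonal argument: the Cauchy property depends
      only on a tail, so it survives if \<open>k2\<close> runs inside \<open>k1\<close> from
      \<open>N\<close> on.\<close>
    fix i N and \<rho> k1 k2 :: "nat \<Rightarrow> nat"
    assume P: "?P i (\<rho> \<circ> k1)" and sub: "\<And>j. N \<le> j \<Longrightarrow> \<exists>j'\<ge>j. k2 j = k1 j'"
    show "?P i (\<rho> \<circ> k2)"
      unfolding uniformly_Cauchy_on_def
    proof (intro allI impI)
      fix e :: real assume "0 < e"
      with P obtain M where M: "\<And>x m n. x \<in> (closed_polydisk (r i) :: (complex ^ 'n) set) \<Longrightarrow> M \<le> m \<Longrightarrow> M \<le> n \<Longrightarrow>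
          dist (f ((\<rho> \<circ> k1) m) x) (f ((\<rho> \<circ> k1) n) x) < e"
        unfolding uniformly_Cauchy_on_def by blast
      show "\<exists>M. \<forall>x\<in>closed_polydisk (r i). \<forall>m\<ge>M. \<forall>n\<ge>M.
          dist (f ((\<rho> \<circ> k2) m) x) (f ((\<rho> \<circ> k2) n) x) < e"
      proof (intro exI ballI allI impI)
        fix x m n assume x: "x \<in> (closed_polydisk (r i) :: (complex ^ 'n) set)" and m: "max M N \<le> m" and n: "max M N \<le> n"
        obtain m' n' where "m' \<ge> m" "k2 m = k1 m'" "n' \<ge> n" "k2 n = k1 n'"
          using sub[of m] sub[of n] m n by auto
        with M[OF x, of m' n'] m n show "dist (f ((\<rho> \<circ> k2) m) x) (f ((\<rho> \<circ> k2) n) x) < e"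
          by simp
      qed
    qed
  qed blast
  show ?thesis
  proof
    show "strict_mono \<rho>" by fact
    fix s :: real assume s: "s < 1"
    obtain i where "1 / (1 - s) < real i" using reals_Archimedean2 by blast
    then have "s \<le> r i" using s by (simp add: r_def field_simps)
    then show "uniformly_Cauchy_on (closed_polydisk s) (\<lambda>j. f (\<rho> j))"
      using \<rho>(2)[of i] closed_polydisk_mono[of s "r i"]
      unfolding uniformly_Cauchy_on_def id_comp by (meson subsetD)
  qed
qed

text \<open>The Cauchy estimate applied to differences \<open>f m - f n\<close>, at the cost of
  passing to a slightly larger radius.\<close>

lemma cpartial_uniformly_Cauchy:
  fixes f :: "nat \<Rightarrow> complex ^ 'n \<Rightarrow> complex"
  assumes f: "\<And>j. holomorphic_cn (f j) polydisk"
    and C: "\<And>r. r < 1 \<Longrightarrow> uniformly_Cauchy_on (closed_polydisk r) f" and r: "r < 1"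
  shows "uniformly_Cauchy_on (closed_polydisk r) (\<lambda>j. cpartial k (f j))"
  unfolding uniformly_Cauchy_on_def
proof (intro allI impI)
  fix e :: real assume e: "0 < e"
  define R where "R = (1 + r) / 2"
  have R: "r < R" "R < 1" using r by (auto simp: R_def)
  \<comment> \<open>The factor \<open>R - r\<close> cancels the denominator of the Cauchy estimate;
    halving \<open>e\<close> makes the final inequality strict.\<close>
  have "0 < e / 2 * (R - r)" using e R by simp
  then obtain N where N: "\<And>x m n. x \<in> closed_polydisk R \<Longrightarrow> N \<le> m \<Longrightarrow> N \<le> n \<Longrightarrow>
      dist (f m x) (f n x) < e / 2 * (R - r)"
    using C[OF R(2)] unfolding uniformly_Cauchy_on_def by blast
  show "\<exists>N. \<forall>x\<in>closed_polydisk r. \<forall>m\<ge>N. \<forall>n\<ge>N. dist (cpartial k (f m) x) (cpartial k (f n) x) < e"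
  proof (intro exI ballI allI impI)
    fix x m n assume x: "x \<in> (closed_polydisk r :: (complex ^ 'n) set)" and mn: "N \<le> m" "N \<le> n"
    have xp: "x \<in> polydisk" using closed_polydisk_subset r x by blast
    have "cmod (cpartial k (\<lambda>z. f m z - f n z) x) \<le> (e / 2 * (R - r)) / (R - r)"
      using N mn
      by (intro cpartial_Cauchy_bound[OF holomorphic_cn_diff(1)[OF f f] R x])
         (auto simp: dist_norm intro: less_imp_le)
    also have "\<dots> = e / 2" using R by (intro nonzero_mult_div_cancel_right) simp
    also have "\<dots> < e" using e by simp
    finally show "dist (cpartial k (f m) x) (cpartial k (f n) x) < e"
      by (simp add: dist_norm holomorphic_cn_diff(2)[OF f f xp])
  qed
qed

text \<open>Termwise differentiation: the functions converge pointwise and their partial derivatives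
  converge uniformly near every point, so the limit has the limits of the partial derivatives as its
  own.\<close>

lemma holomorphic_cn_limit:
  fixes f :: "nat \<Rightarrow> complex ^ 'n \<Rightarrow> complex"
  assumes f: "\<And>j. holomorphic_cn (f j) polydisk"
    and C: "\<And>r. r < 1 \<Longrightarrow> uniformly_Cauchy_on (closed_polydisk r) f"
  obtains g where "holomorphic_cn g polydisk" "\<And>z. z \<in> polydisk \<Longrightarrow> (\<lambda>j. f j z) \<longlonglongrightarrow> g z"
    "\<And>k r. r < 1 \<Longrightarrow>
      uniform_limit (closed_polydisk r) (\<lambda>j. cpartial k (f j)) (cpartial k g) sequentially"
proof -
  define G where "G k z = lim (\<lambda>j. cpartial k (f j) z)" for k z
  define g where "g z = lim (\<lambda>j. f j z)" for z
  have G: "uniform_limit (closed_polydisk r) (\<lambda>j. cpartial k (f j)) (G k) sequentially" if "r < 1" for k r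
    using Cauchy_uniformly_convergent[OF cpartial_uniformly_Cauchy[OF f C that]]
    unfolding uniformly_convergent_uniform_limit_iff G_def by simp
  have g: "(\<lambda>j. f j z) \<longlonglongrightarrow> g z" if z: "z \<in> polydisk" for z
  proof -
    obtain r where r: "r < 1" "z \<in> closed_polydisk r" using polydisk_in_closed_polydisk[OF z] by metis
    have "uniform_limit (closed_polydisk r) f g sequentially"
      using Cauchy_uniformly_convergent[OF C[OF r(1)]]
      unfolding uniformly_convergent_uniform_limit_iff g_def by simp
    then show ?thesis by (rule tendsto_uniform_limitI) (rule r(2))
  qed
  have D: "(g has_derivative (\<lambda>v. \<Sum>k\<in>UNIV. G k z * v $ k)) (at z)" if z: "z \<in> polydisk" for z
  proof -
    obtain r where r: "r < 1" "z \<in> closed_polydisk r" using polydisk_in_closed_polydisk[OF z] by metis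
    define R where "R = (1 + r) / 2"
    have R: "r < R" "R < 1" using r by (auto simp: R_def)
    \<comment> \<open>Each coordinate moves by less than \<open>R - r\<close> in this ball, so
      uniform convergence on the closed polydisk of radius \<open>R\<close> is available
      there.\<close>
    let ?B = "ball z (R - r)"
    have B: "?B \<subseteq> closed_polydisk R"
    proof
      fix w assume w: "w \<in> ?B"
      have "cmod (w $ k) \<le> R" for k
      proof -
        have "cmod (w $ k) \<le> cmod (z $ k) + cmod ((w - z) $ k)"
          using norm_triangle_ineq[of "z $ k" "(w - z) $ k"] by simp
        also have "\<dots> \<le> r + (R - r)"
        proof (rule add_mono)
          show "cmod (z $ k) \<le> r" using r by (simp add: closed_polydisk_def)
          have "norm (w - z) < R - r" using w by (simp add: dist_norm norm_minus_commute)
          then show "cmod ((w - z) $ k) \<le> R - r"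
            using Finite_Cartesian_Product.norm_nth_le[of "w - z" k] by linarith
        qed
        finally show ?thesis by simp
      qed
      then show "w \<in> closed_polydisk R" by (simp add: closed_polydisk_def)
    qed
    then have Bp: "?B \<subseteq> polydisk" using closed_polydisk_subset[OF R(2)] by (rule order_trans)
    have "\<exists>h. \<forall>x\<in>?B. (\<lambda>n. f n x) \<longlonglongrightarrow> h x \<and>
        (h has_derivative (\<lambda>v. \<Sum>k\<in>UNIV. G k x * v $ k)) (at x within ?B)"
    proof (rule has_derivative_sequence[where f = f
          and f' = "\<lambda>n x v. \<Sum>k\<in>UNIV. cpartial k (f n) x * v $ k"
          and g' = "\<lambda>x v. \<Sum>k\<in>UNIV. G k x * v $ k", OF convex_ball])
      show "(f n has_derivative (\<lambda>v. \<Sum>k\<in>UNIV. cpartial k (f n) x * v $ k)) (at x within ?B)"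
        if "x \<in> ?B" for n x
        by (rule has_derivative_at_withinI[OF holomorphic_cn_has_derivative[OF f subsetD[OF Bp that]]])
      show "z \<in> ?B" using R by simp
      show "(\<lambda>n. f n z) \<longlonglongrightarrow> g z" by (rule g[OF z])
      fix e :: real assume e: "0 < e"
      \<comment> \<open>Each of the \<open>CARD('n)\<close> directions contributes at most this
        share of the error.\<close>
      let ?d = "e / CARD('n)"
      have "0 < ?d" using e by simp
      then have "\<forall>\<^sub>F n in sequentially. \<forall>x\<in>closed_polydisk R. dist (cpartial k (f n) x) (G k x) < ?d" for k
        using G[OF R(2)] unfolding uniform_limit_iff by blast
      then have "\<forall>\<^sub>F n in sequentially. \<forall>k. \<forall>x\<in>closed_polydisk R. dist (cpartial k (f n) x) (G k x) < ?d"
        by (simp add: eventually_all_finite)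
      then show "\<forall>\<^sub>F n in sequentially. \<forall>x\<in>?B. \<forall>h.
          norm ((\<Sum>k\<in>UNIV. cpartial k (f n) x * h $ k) - (\<Sum>k\<in>UNIV. G k x * h $ k)) \<le> e * norm h"
      proof (rule eventually_mono, intro ballI allI)
        fix n x and h :: "complex ^ 'n"
        assume n: "\<forall>k. \<forall>x\<in>closed_polydisk R. dist (cpartial k (f n) x) (G k x) < ?d" and x: "x \<in> ?B"
        have "norm ((\<Sum>k\<in>UNIV. cpartial k (f n) x * h $ k) - (\<Sum>k\<in>UNIV. G k x * h $ k))
            = norm (\<Sum>k\<in>UNIV. (cpartial k (f n) x - G k x) * h $ k)"
          by (simp add: sum_subtractf left_diff_distrib)
        also have "\<dots> \<le> (\<Sum>k\<in>(UNIV :: 'n set). ?d * norm h)"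
        proof (rule sum_norm_le)
          fix k
          show "norm ((cpartial k (f n) x - G k x) * h $ k) \<le> ?d * norm h"
            unfolding norm_mult using n x B e
            by (intro mult_mono Finite_Cartesian_Product.norm_nth_le) (auto simp: dist_norm intro!: less_imp_le)
        qed
        finally show "norm ((\<Sum>k\<in>UNIV. cpartial k (f n) x * h $ k) - (\<Sum>k\<in>UNIV. G k x * h $ k)) \<le> e * norm h"
          by simp
      qed
    qed
    then obtain h where h: "\<And>x. x \<in> ?B \<Longrightarrow> (\<lambda>n. f n x) \<longlonglongrightarrow> h x"
      and hd: "\<And>x. x \<in> ?B \<Longrightarrow> (h has_derivative (\<lambda>v. \<Sum>k\<in>UNIV. G k x * v $ k)) (at x within ?B)"
      by blast
    have z_in: "z \<in> ?B" using R by simp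
    \<comment> \<open>The differentiable limit \<open>h\<close> depends on the ball; it agrees there
      with the global \<open>g\<close> by uniqueness of pointwise limits.\<close>
    have "(h has_derivative (\<lambda>v. \<Sum>k\<in>UNIV. G k z * v $ k)) (at z)"
      using hd[OF z_in] at_within_open[OF z_in open_ball] by simp
    then show ?thesis
      by (rule has_derivative_transform_within_open[OF _ open_ball z_in])
         (rule LIMSEQ_unique[OF h g], use Bp in auto)
  qed
  have cp: "cpartial k g z = G k z" if "z \<in> polydisk" for k z
    by (rule cpartial_eqI[OF D[OF that]])
  show thesis
  proof
    show "holomorphic_cn g polydisk" using D by (rule holomorphic_cnI)
    show "(\<lambda>j. f j z) \<longlonglongrightarrow> g z" if "z \<in> polydisk" for z by (rule g[OF that])
    show "uniform_limit (closed_polydisk r) (\<lambda>j. cpartial k (f j)) (cpartial k g) sequentially"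
      if "r < 1" for k r
      using G[OF that, of k] closed_polydisk_subset[OF that] cp
      by (subst uniform_limit_cong'[where g = "\<lambda>j. cpartial k (f j)" and i = "G k"]) auto
  qed
qed

text \<open>The bounds pass to the limit pointwise, since the seminorm at a point is a finite sum of
  moduli of convergent partial derivatives with fixed weights.\<close>

lemma bloch_Montel:
  fixes f :: "nat \<Rightarrow> complex ^ 'n \<Rightarrow> complex"
  assumes f: "\<And>j. holomorphic_cn (f j) polydisk"
    and A: "\<And>j z. z \<in> polydisk \<Longrightarrow> bloch_seminorm_at p (f j) z \<le> A"
    and f0: "\<And>j. cmod (f j 0) \<le> A" and p: "0 \<le> p"
  obtains g and \<rho> :: "nat \<Rightarrow> nat" where "strict_mono \<rho>" "holomorphic_cn g polydisk"
    "\<And>z. z \<in> polydisk \<Longrightarrow> (\<lambda>j. f (\<rho> j) z) \<longlonglongrightarrow> g z"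
    "\<And>k r. r < 1 \<Longrightarrow>
      uniform_limit (closed_polydisk r) (\<lambda>j. cpartial k (f (\<rho> j))) (cpartial k g) sequentially"
    "\<And>z. z \<in> polydisk \<Longrightarrow> bloch_seminorm_at p g z \<le> A" "cmod (g 0) \<le> A"
proof -
  obtain \<rho> :: "nat \<Rightarrow> nat" where \<rho>: "strict_mono \<rho>"
    and C: "\<And>r. r < 1 \<Longrightarrow> uniformly_Cauchy_on (closed_polydisk r) (\<lambda>j. f (\<rho> j))"
    by (rule bloch_locally_uniform_subsequence[where f = f, OF f A f0 p]) blast+
  obtain g where g: "holomorphic_cn g polydisk" "\<And>z. z \<in> polydisk \<Longrightarrow> (\<lambda>j. f (\<rho> j) z) \<longlonglongrightarrow> g z"
    "\<And>k r. r < 1 \<Longrightarrow>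
      uniform_limit (closed_polydisk r) (\<lambda>j. cpartial k (f (\<rho> j))) (cpartial k g) sequentially"
    by (rule holomorphic_cn_limit[where f = "\<lambda>j. f (\<rho> j)", OF f C]) blast+
  have gA: "bloch_seminorm_at p g z \<le> A" if z: "z \<in> polydisk" for z
  proof -
    obtain r where r: "r < 1" "z \<in> closed_polydisk r" using polydisk_in_closed_polydisk[OF z] by metis
    have "(\<lambda>j. cpartial k (f (\<rho> j)) z) \<longlonglongrightarrow> cpartial k g z" for k
      using tendsto_uniform_limitI[OF g(3)[OF r(1)] r(2)] .
    then have "(\<lambda>j. bloch_seminorm_at p (f (\<rho> j)) z) \<longlonglongrightarrow> bloch_seminorm_at p g z"
      unfolding bloch_seminorm_at_def by (intro tendsto_intros)
    then show ?thesis using A[OF z] by (intro LIMSEQ_le_const2) auto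
  qed
  have g0A: "cmod (g 0) \<le> A"
    using tendsto_norm[OF g(2)[OF zero_in_polydisk]] f0 by (intro LIMSEQ_le_const2) auto
  show thesis by (rule that[OF \<rho> g gA g0A])
qed

subsection \<open>Seminorms of composed functions\<close>

lemma bloch_seminorm_comp_le:
  fixes h :: "complex ^ 'm \<Rightarrow> complex" and \<phi> :: "complex ^ 'n \<Rightarrow> complex ^ 'm"
  assumes h: "holomorphic_cn h polydisk" and \<phi>: "\<And>l. holomorphic_cn (\<lambda>z. \<phi> z $ l) polydisk"
    and im: "\<phi> ` polydisk \<subseteq> polydisk" and z: "z \<in> polydisk"
  shows "bloch_seminorm_at q (\<lambda>z. h (\<phi> z)) z \<le> (\<Sum>k\<in>UNIV. \<Sum>l\<in>UNIV.
    cmod (cpartial l h (\<phi> z)) * cmod (cpartial k (\<lambda>w. \<phi> w $ l) z) * (1 - (cmod (z $ k))\<^sup>2) powr q)"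
  unfolding bloch_seminorm_at_def
    cpartial_eqI[OF holomorphic_cn_compose_has_derivative[OF h \<phi> im z]] sum_distrib_right[symmetric]
  by (intro sum_mono mult_right_mono sum_norm_le) (auto simp: norm_mult)

text \<open>In each term of the chain rule the weight of \<open>\<phi> z $ l\<close> is inserted and
  divided out again. The hypothesis concerns only the point \<open>\<phi> z\<close>, so it can be
  used with different constants near the boundary and away from it.\<close>

lemma bloch_seminorm_comp_le_weight:
  fixes h :: "complex ^ 'n \<Rightarrow> complex" and \<phi> :: "complex ^ 'n \<Rightarrow> complex ^ 'n"
  assumes h: "holomorphic_cn h polydisk" and \<phi>: "\<And>l. holomorphic_cn (\<lambda>z. \<phi> z $ l) polydisk"
    and im: "\<phi> ` polydisk \<subseteq> polydisk" and z: "z \<in> polydisk"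
    and le: "\<And>l. cmod (cpartial l h (\<phi> z)) * (1 - (cmod (\<phi> z $ l))\<^sup>2) powr p \<le> A"
  shows "bloch_seminorm_at q (\<lambda>z. h (\<phi> z)) z \<le> A * comp_weight_sum p q \<phi> z"
proof -
  have "cmod (cpartial l h (\<phi> z)) * cmod (cpartial k (\<lambda>w. \<phi> w $ l) z) * (1 - (cmod (z $ k))\<^sup>2) powr q
      \<le> A * (cmod (cpartial k (\<lambda>w. \<phi> w $ l) z) *
        ((1 - (cmod (z $ k))\<^sup>2) powr q / (1 - (cmod (\<phi> z $ l))\<^sup>2) powr p))" for k l
  proof -
    have "0 < 1 - (cmod (\<phi> z $ l))\<^sup>2" using im z by (intro polydisk_one_minus_sq) auto
    then have "cmod (cpartial l h (\<phi> z)) \<le> A / (1 - (cmod (\<phi> z $ l))\<^sup>2) powr p"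
      using le[of l] by (simp add: pos_le_divide_eq)
    then have "cmod (cpartial l h (\<phi> z)) *
        (cmod (cpartial k (\<lambda>w. \<phi> w $ l) z) * (1 - (cmod (z $ k))\<^sup>2) powr q)
      \<le> A / (1 - (cmod (\<phi> z $ l))\<^sup>2) powr p *
        (cmod (cpartial k (\<lambda>w. \<phi> w $ l) z) * (1 - (cmod (z $ k))\<^sup>2) powr q)"
      by (rule mult_right_mono) simp
    then show ?thesis by (simp add: mult_ac)
  qed
  then show ?thesis
    unfolding comp_weight_sum_def sum_distrib_left
    by (intro order_trans[OF bloch_seminorm_comp_le[OF h \<phi> im z]] sum_mono)
qed

section \<open>Rules for Bloch norms, restrictions and composed functions\<close>

lemma bloch_seminorm_at_term_le:
  "cmod (cpartial k f z) * (1 - (cmod (z $ k))\<^sup>2) powr p \<le> bloch_seminorm_at p f z"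
  unfolding bloch_seminorm_at_def
  by (rule member_le_sum[where f = "\<lambda>k. cmod (cpartial k f z) * (1 - (cmod (z $ k))\<^sup>2) powr p"]) auto

lemma comp_weight_sum_nonneg: "0 \<le> comp_weight_sum p q \<phi> z"
  unfolding comp_weight_sum_def by (intro sum_nonneg) auto

lemma bloch_seminorm_at_transform:
  assumes "holomorphic_cn f polydisk" "\<And>z. z \<in> polydisk \<Longrightarrow> f z = g z" "z \<in> polydisk"
  shows "bloch_seminorm_at p g z = bloch_seminorm_at p f z"
  unfolding bloch_seminorm_at_def
  using holomorphic_cn_transform(2)[OF assms(1) polydisk_open assms(2,3)] by simp

lemma bloch_norm_transform:
  assumes "holomorphic_cn f polydisk" "\<And>z. z \<in> polydisk \<Longrightarrow> f z = g z"
  shows "bloch_norm p g = bloch_norm p f"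
  unfolding bloch_norm_def
  using bloch_seminorm_at_transform[OF assms] assms(2)[OF zero_in_polydisk] by (simp cong: SUP_cong)

lemma bloch_norm_le:
  assumes "cmod (f 0) \<le> A" "\<And>z. z \<in> polydisk \<Longrightarrow> bloch_seminorm_at p f z \<le> B"
  shows "bloch_norm p f \<le> A + B"
  unfolding bloch_norm_def by (intro add_mono cSUP_least ne_polydisk assms)

lemma bloch_norm_ge:
  assumes "bdd_above (bloch_seminorm_at p f ` polydisk)"
  shows "cmod (f 0) \<le> bloch_norm p f"
    and "z \<in> polydisk \<Longrightarrow> bloch_seminorm_at p f z \<le> bloch_norm p f"
  using bloch_norm_seminorm_nonneg[OF assms] cSUP_upper[OF _ assms, of z] norm_ge_zero[of "f 0"]
  unfolding bloch_norm_def by linarith+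

lemma restrict_in_bloch:
  assumes f: "holomorphic_cn f polydisk" and A: "\<And>z. z \<in> polydisk \<Longrightarrow> bloch_seminorm_at p f z \<le> A"
  shows "restrict f polydisk \<in> bloch p"
  unfolding bloch_def
proof (intro CollectI conjI)
  show "holomorphic_cn (restrict f polydisk) polydisk"
    by (rule holomorphic_cn_transform(1)[OF f polydisk_open]) simp
  show "bdd_above (bloch_seminorm_at p (restrict f polydisk) ` polydisk)"
    using A bloch_seminorm_at_transform[OF f, of "restrict f polydisk"] by (intro bdd_aboveI2[where M = A]) simp
qed simp

lemma blochD:
  assumes "f \<in> bloch p"
  shows "holomorphic_cn f polydisk" "bdd_above (bloch_seminorm_at p f ` polydisk)"
  using assms by (auto simp: bloch_def)

lemma holomorphic_cn_zero: "holomorphic_cn (\<lambda>_. 0) S" and cpartial_zero: "cpartial k (\<lambda>_. 0) z = 0"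
proof -
  show "holomorphic_cn (\<lambda>_. 0) S" by (rule holomorphic_cnI[where c = "\<lambda>_ _. 0"]) simp
  show "cpartial k (\<lambda>_. 0) z = 0" by (simp add: cpartial_def)
qed

lemma zero_in_bloch: "restrict (\<lambda>_. 0) polydisk \<in> bloch p"
  by (rule restrict_in_bloch[where A = 0, OF holomorphic_cn_zero]) (simp add: bloch_seminorm_at_def cpartial_zero)

lemma bloch_dist_zero:
  assumes f: "f \<in> bloch p"
  shows "bloch_dist p f (restrict (\<lambda>_. 0) polydisk) = bloch_norm p f"
  using bloch_norm_transform[OF blochD(1)[OF f], of "\<lambda>z. f z - restrict (\<lambda>_. 0) polydisk z" p] f
  by (simp add: bloch_dist_def zero_in_bloch)

lemma composition_op_in_bloch:
  fixes \<phi> :: "complex ^ 'n \<Rightarrow> complex ^ 'n"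
  assumes f: "f \<in> bloch p" and \<phi>: "\<And>l. holomorphic_cn (\<lambda>z. \<phi> z $ l) polydisk"
    and im: "\<phi> ` polydisk \<subseteq> polydisk" and M: "\<And>z. z \<in> polydisk \<Longrightarrow> comp_weight_sum p q \<phi> z \<le> M"
  shows "composition_op \<phi> f \<in> bloch q"
proof -
  let ?A = "bloch_norm p f"
  have A: "bloch_seminorm_at p f z \<le> ?A" if "z \<in> polydisk" for z
    using bloch_norm_ge(2)[OF blochD(2)[OF f] that] .
  have A0: "0 \<le> ?A" using A[OF zero_in_polydisk] bloch_seminorm_at_nonneg order_trans by blast
  have "restrict (\<lambda>z. f (\<phi> z)) polydisk \<in> bloch q"
  proof (rule restrict_in_bloch)
    show "holomorphic_cn (\<lambda>z. f (\<phi> z)) polydisk"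
      by (rule holomorphic_cnI[OF holomorphic_cn_compose_has_derivative[OF blochD(1)[OF f] \<phi> im]])
    fix z :: "complex ^ 'n" assume z: "z \<in> polydisk"
    have \<phi>z: "\<phi> z \<in> polydisk" using im z by blast
    have "bloch_seminorm_at q (\<lambda>z. f (\<phi> z)) z \<le> ?A * comp_weight_sum p q \<phi> z"
      by (rule bloch_seminorm_comp_le_weight[OF blochD(1)[OF f] \<phi> im z])
         (rule order_trans[OF bloch_seminorm_at_term_le A[OF \<phi>z]])
    also have "\<dots> \<le> ?A * M" using A0 M[OF z] by (rule mult_left_mono[rotated])
    finally show "bloch_seminorm_at q (\<lambda>z. f (\<phi> z)) z \<le> ?A * M" .
  qed
  then show ?thesis by (simp add: composition_op_def compose_def)
qed

text \<open>The restriction built into \<open>composition_op\<close> affects only points outside of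
  the polydisk, which the norm does not see.\<close>

lemma bloch_dist_composition_op:
  assumes \<phi>: "\<And>l. holomorphic_cn (\<lambda>z. \<phi> z $ l) polydisk"
    and im: "\<phi> ` polydisk \<subseteq> polydisk" and f: "f \<in> bloch p" and g: "g \<in> bloch p"
    and in_q: "composition_op \<phi> f \<in> bloch q" "composition_op \<phi> g \<in> bloch q"
  shows "bloch_dist q (composition_op \<phi> f) (composition_op \<phi> g) = bloch_norm q (\<lambda>z. f (\<phi> z) - g (\<phi> z))"
proof -
  have "holomorphic_cn (\<lambda>z. f (\<phi> z) - g (\<phi> z)) polydisk"
    by (rule holomorphic_cnI[OF holomorphic_cn_compose_has_derivative[OF bloch_diff(1)[OF f g] \<phi> im]])
  from bloch_norm_transform[OF this, of "\<lambda>z. composition_op \<phi> f z - composition_op \<phi> g z" q] in_q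
  show ?thesis by (simp add: bloch_dist_def composition_op_def compose_def)
qed

subsection \<open>Compactness from the weight condition\<close>

text \<open>Moving the \<open>l\<close>-th coordinate radially to the unit circle leaves the
  polydisk and costs the distance \<open>1 - cmod (w $ l)\<close>.\<close>

lemma infdist_frontier_polydisk_less:
  fixes w :: "complex ^ 'n"
  assumes w: "w \<in> polydisk" and l: "1 - \<delta> < cmod (w $ l)" and \<delta>: "0 < \<delta>"
  shows "infdist w (frontier polydisk) < \<delta>"
proof -
  let ?a = "cmod (w $ l)"
  \<comment> \<open>The radial projection of \<open>w $ l\<close> to the unit circle; at 0 every
    direction serves.\<close>
  define c where "c = (if w $ l = 0 then 1 else w $ l / of_real ?a)"
  define b where "b = (\<chi> j. if j = l then c else w $ j)"
  have c: "cmod c = 1" "cmod (w $ l - c) = 1 - ?a"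
  proof -
    show "cmod c = 1" by (simp add: c_def norm_divide)
    have "w $ l - c = of_real (?a - 1) * c" by (simp add: c_def field_simps)
    then have "cmod (w $ l - c) = \<bar>?a - 1\<bar>"
      using \<open>cmod c = 1\<close> by (simp only: norm_mult norm_of_real mult_1_right)
    moreover have "?a < 1" using w by (simp add: polydisk_def)
    ultimately show "cmod (w $ l - c) = 1 - ?a" by simp
  qed
  have "norm (w - b) \<le> (\<Sum>k\<in>UNIV. cmod ((w - b) $ k))"
    unfolding norm_vec_def by (rule L2_set_le_sum) simp
  also have "\<dots> = (\<Sum>k\<in>UNIV. if k = l then cmod (w $ l - c) else 0)"
    by (intro sum.cong) (auto simp: b_def)
  finally have wb: "dist w b < \<delta>"
    using c(2) l by (simp add: dist_norm)
  have "b $ l = c" by (simp add: b_def)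
  then have "b \<notin> polydisk" using c(1) by (auto simp: polydisk_def intro!: exI[of _ l])
  \<comment> \<open>A segment from inside to outside meets the frontier, at a point no farther from
    \<open>w\<close> than \<open>b\<close>.\<close>
  then have "closed_segment w b \<inter> frontier polydisk \<noteq> {}"
    using w by (intro connected_Int_frontier) auto
  then obtain y where y: "y \<in> closed_segment w b" "y \<in> frontier polydisk" by blast
  have "dist w y \<le> dist w b"
    using segment_bound(1)[OF y(1)] by (simp add: dist_norm norm_minus_commute)
  with infdist_le[OF y(2), of w] wb show ?thesis by simp
qed

text \<open>A frontier point of the open polydisk lies outside of it and so has a coordinate of
  modulus at least 1; a point near it has the same coordinate near the unit circle.\<close>

lemma infdist_frontier_polydiskE:
  fixes w :: "complex ^ 'n"
  assumes "infdist w (frontier polydisk) < \<delta>"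
  obtains l where "1 - \<delta> < cmod (w $ l)"
proof -
  \<comment> \<open>\<open>infdist\<close> to the empty set would be 0 by convention, and then the
    hypothesis would yield no frontier point.\<close>
  have "frontier (polydisk :: (complex ^ 'n) set) \<noteq> {}"
  proof
    assume "frontier (polydisk :: (complex ^ 'n) set) = {}"
    then have "(polydisk :: (complex ^ 'n) set) = UNIV"
      by (simp add: frontier_eq_empty ne_polydisk)
    moreover have "(1 :: complex ^ 'n) \<notin> polydisk" by (simp add: polydisk_def)
    ultimately show False by blast
  qed
  then obtain b where b: "b \<in> frontier polydisk" "dist w b < \<delta>"
    using assms by (auto simp: infdist_def cINF_less_iff)
  have "b \<notin> polydisk"
    using b(1) by (simp add: frontier_def interior_open[OF polydisk_open])
  then obtain l where l: "1 \<le> cmod (b $ l)" by (auto simp: polydisk_def not_less)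
  have "cmod (b $ l) \<le> cmod (w $ l) + cmod ((w - b) $ l)"
    using norm_triangle_ineq4[of "w $ l" "(w - b) $ l"] by simp
  also have "\<dots> < cmod (w $ l) + \<delta>"
    using b(2) Finite_Cartesian_Product.norm_nth_le[of "w - b" l] by (simp add: dist_norm)
  finally show thesis using l that[of l] by simp
qed

lemma bloch_mbounded_bound:
  assumes "Metric_space.mbounded (bloch p) (bloch_dist p) B"
  obtains A where "\<And>f. f \<in> B \<Longrightarrow> f \<in> bloch p" "\<And>f. f \<in> B \<Longrightarrow> bloch_norm p f \<le> A"
proof -
  interpret X: Metric_space "bloch p" "bloch_dist p" by (rule Metric_space_bloch)
  \<comment> \<open>Adding the zero function turns a bound on mutual distances into a bound on
    norms.\<close>
  have "X.mbounded (insert (restrict (\<lambda>_. 0) polydisk) B)"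
    using assms zero_in_bloch by (simp add: X.mbounded_insert)
  then obtain A where "\<And>f. f \<in> B \<Longrightarrow> f \<in> bloch p"
    "\<And>f. f \<in> B \<Longrightarrow> bloch_dist p f (restrict (\<lambda>_. 0) polydisk) \<le> A"
    unfolding X.mbounded_alt by blast
  then show thesis using bloch_dist_zero that by metis
qed

lemma composition_op_compact:
  fixes \<phi> :: "complex ^ 'n \<Rightarrow> complex ^ 'n"
  assumes \<phi>: "\<And>l. holomorphic_cn (\<lambda>z. \<phi> z $ l) polydisk"
    and im: "\<phi> ` polydisk \<subseteq> polydisk" and p: "0 \<le> p"
    and van: "vanishes_at_image_boundary \<phi> (comp_weight_sum p q \<phi>)"
    and M: "\<And>z. z \<in> polydisk \<Longrightarrow> comp_weight_sum p q \<phi> z \<le> M"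
  shows "compact_operator (bloch p) (bloch_dist p) (bloch q) (bloch_dist q) (composition_op \<phi>)"
  unfolding compact_operator_def
proof (intro conjI allI impI)
  let ?T = "composition_op \<phi>"
  interpret Y: Metric_space "bloch q" "bloch_dist q" by (rule Metric_space_bloch)
  have T: "?T f \<in> bloch q" if "f \<in> bloch p" for f
    using that \<phi> im M by (rule composition_op_in_bloch)
  then show T_im: "?T ` bloch p \<subseteq> bloch q" by blast
  fix B :: "(complex ^ 'n \<Rightarrow> complex) set"
  assume "Metric_space.mbounded (bloch p) (bloch_dist p) B"
  then obtain A where A: "\<And>f. f \<in> B \<Longrightarrow> f \<in> bloch p" "\<And>f. f \<in> B \<Longrightarrow> bloch_norm p f \<le> A"
    by (rule bloch_mbounded_bound) blast+
  \<comment> \<open>\<open>K\<close> is closed under locally uniform limits, so its image is compact and not just relatively compact.\<close>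
  define K :: "(complex ^ 'n \<Rightarrow> complex) set" where "K = {f \<in> bloch p. cmod (f 0) \<le> A \<and> (\<forall>z\<in>polydisk. bloch_seminorm_at p f z \<le> A)}"
  have BK: "B \<subseteq> K"
    unfolding K_def using A bloch_norm_ge[OF blochD(2)] by (blast intro: order_trans)
  have "compactin Y.mtopology (?T ` K)"
    unfolding Y.compactin_sequentially
  proof (intro conjI allI impI)
    show "?T ` K \<subseteq> bloch q" using T_im by (auto simp: K_def)
    fix \<sigma> :: "nat \<Rightarrow> complex ^ 'n \<Rightarrow> complex" assume "range \<sigma> \<subseteq> ?T ` K"
    then have "\<forall>j. \<exists>f. f \<in> K \<and> \<sigma> j = ?T f" by (simp add: image_subset_iff) blast
    then obtain f where f: "\<And>j. f j \<in> K" "\<And>j. \<sigma> j = ?T (f j)" by metis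
    have fp: "f j \<in> bloch p" "cmod (f j 0) \<le> A"
      "z \<in> polydisk \<Longrightarrow> bloch_seminorm_at p (f j) z \<le> A" for j z
      using f(1)[of j] by (auto simp: K_def)
    obtain g0 and \<rho> :: "nat \<Rightarrow> nat" where \<rho>: "strict_mono \<rho>" and g0: "holomorphic_cn g0 polydisk"
      and lim0: "\<And>z. z \<in> polydisk \<Longrightarrow> (\<lambda>j. f (\<rho> j) z) \<longlonglongrightarrow> g0 z"
      and ulim0: "\<And>k r. r < 1 \<Longrightarrow>
        uniform_limit (closed_polydisk r) (\<lambda>j. cpartial k (f (\<rho> j))) (cpartial k g0) sequentially"
      and A0: "\<And>z. z \<in> polydisk \<Longrightarrow> bloch_seminorm_at p g0 z \<le> A" "cmod (g0 0) \<le> A"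
      by (rule bloch_Montel[where f = f, OF blochD(1)[OF fp(1)] fp(3) fp(2) p]) blast+
    define g where "g = restrict g0 polydisk"
    have g_eq: "g z = g0 z" "bloch_seminorm_at p g z = bloch_seminorm_at p g0 z"
      "cpartial k g z = cpartial k g0 z" if "z \<in> polydisk" for k z
      using bloch_seminorm_at_transform[OF g0, of g z p] holomorphic_cn_transform(2)[OF g0 polydisk_open, of g z k] that
      by (auto simp: g_def)
    have gp: "g \<in> bloch p" unfolding g_def by (rule restrict_in_bloch[OF g0 A0(1)])
    have gK: "g \<in> K"
      using gp A0 g_eq(1)[OF zero_in_polydisk] g_eq(2) by (auto simp: K_def)
    have gA: "bloch_seminorm_at p g z \<le> A" if "z \<in> polydisk" for z
      using gK that by (auto simp: K_def)
    let ?h = "\<lambda>j z. f (\<rho> j) z - g z"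
    have h: "holomorphic_cn (?h j) polydisk" for j
      by (rule bloch_diff(1)[OF fp(1) gp])
    have hA: "bloch_seminorm_at p (?h j) z \<le> 2 * A" if "z \<in> polydisk" for j z
      using bloch_seminorm_at_triangle[OF holomorphic_cn_diff(2)[OF blochD(1)[OF fp(1)[of "\<rho> j"]] blochD(1)[OF gp] that], of p]
        fp(3)[OF that, of "\<rho> j"] gA[OF that] by linarith
    have A_nonneg: "0 \<le> A" using A0(2) norm_ge_zero order_trans by blast
    have M0: "0 \<le> M" using M[OF zero_in_polydisk] comp_weight_sum_nonneg order_trans by blast
    have "limitin Y.mtopology (\<sigma> \<circ> \<rho>) (?T g) sequentially"
      unfolding Y.limitin_metric
    proof (intro conjI allI impI)
      show "?T g \<in> bloch q" by (rule T[OF gp])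
      fix \<epsilon> :: real assume \<epsilon>: "0 < \<epsilon>"
      \<comment> \<open>Near the boundary the difference has seminorm at most \<open>2 * A\<close>,
        so this tolerance for the weight sum leaves a third of \<open>\<epsilon>\<close>. The
        summand 1 covers \<open>A = 0\<close>.\<close>
      define \<epsilon>1 where "\<epsilon>1 = \<epsilon> / (6 * A + 1)"
      have \<epsilon>1: "0 < \<epsilon>1" "2 * A * \<epsilon>1 \<le> \<epsilon> / 3"
        using \<epsilon> A_nonneg by (auto simp: \<epsilon>1_def field_simps)
      obtain \<delta> where \<delta>: "0 < \<delta>" and near: "\<And>z. z \<in> polydisk \<Longrightarrow>
          infdist (\<phi> z) (frontier polydisk) < \<delta> \<Longrightarrow> \<bar>comp_weight_sum p q \<phi> z\<bar> < \<epsilon>1"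
        using van \<epsilon>1(1) unfolding vanishes_at_image_boundary_def by blast
      \<comment> \<open>Away from the boundary the roles are exchanged: the weight sum is only
        bounded by \<open>M\<close>, and the partial derivatives are small.\<close>
      define \<eta> where "\<eta> = \<epsilon> / (3 * (M + 1))"
      have \<eta>: "0 < \<eta>" "\<eta> * M \<le> \<epsilon> / 3"
        using \<epsilon> M0 by (auto simp: \<eta>_def field_simps)
      \<comment> \<open>For \<open>\<delta> > 1\<close> the closed polydisk below is empty and the
        uniform estimate is vacuous.\<close>
      have "1 - \<delta> < 1" using \<delta> by simp
      then have "\<forall>\<^sub>F j in sequentially. \<forall>w\<in>closed_polydisk (1 - \<delta>).
          dist (cpartial k (f (\<rho> j)) w) (cpartial k g0 w) < \<eta>" for k
        using ulim0 \<eta>(1) unfolding uniform_limit_iff by blast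
      then have far_ev: "\<forall>\<^sub>F j in sequentially. \<forall>k. \<forall>w\<in>closed_polydisk (1 - \<delta>).
          dist (cpartial k (f (\<rho> j)) w) (cpartial k g0 w) < \<eta>"
        by (simp add: eventually_all_finite)
      have \<phi>0: "\<phi> 0 \<in> polydisk" using im zero_in_polydisk by blast
      have "\<forall>\<^sub>F j in sequentially. dist (f (\<rho> j) (\<phi> 0)) (g0 (\<phi> 0)) < \<epsilon> / 4"
        by (rule tendstoD[OF lim0[OF \<phi>0]]) (use \<epsilon> in simp)
      with far_ev
      show "\<forall>\<^sub>F j in sequentially. (\<sigma> \<circ> \<rho>) j \<in> bloch q \<and> bloch_dist q ((\<sigma> \<circ> \<rho>) j) (?T g) < \<epsilon>"
      proof eventually_elim
        case (elim j)
        have "bloch_seminorm_at q (\<lambda>z. ?h j (\<phi> z)) z \<le> \<epsilon> / 3" if z: "z \<in> polydisk" for z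
        proof (cases "infdist (\<phi> z) (frontier polydisk) < \<delta>")
          case True
          have \<phi>z: "\<phi> z \<in> polydisk" using im z by blast
          have "bloch_seminorm_at q (\<lambda>z. ?h j (\<phi> z)) z \<le> 2 * A * comp_weight_sum p q \<phi> z"
            by (rule bloch_seminorm_comp_le_weight[OF h \<phi> im z])
               (rule order_trans[OF bloch_seminorm_at_term_le hA[OF \<phi>z]])
          also have "\<dots> \<le> 2 * A * \<epsilon>1"
            using near[OF z True] A_nonneg by (intro mult_left_mono) auto
          finally show ?thesis using \<epsilon>1 by simp
        next
          case False
          have \<phi>z: "\<phi> z \<in> polydisk" using im z by blast
          \<comment> \<open>A coordinate of modulus above \<open>1 - \<delta>\<close> would put
            \<open>\<phi> z\<close> within \<open>\<delta>\<close> of the boundary.\<close>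
          have "\<phi> z \<in> closed_polydisk (1 - \<delta>)"
            using infdist_frontier_polydisk_less[OF \<phi>z _ \<delta>] False
            unfolding closed_polydisk_def by (force simp: not_less)
          then have le: "cmod (cpartial l (?h j) (\<phi> z)) \<le> \<eta>" for l
            using elim(1) g_eq(3)[OF \<phi>z]
            by (auto simp: holomorphic_cn_diff(2)[OF blochD(1)[OF fp(1)] blochD(1)[OF gp] \<phi>z] dist_norm intro: less_imp_le)
          have "bloch_seminorm_at q (\<lambda>z. ?h j (\<phi> z)) z \<le> \<eta> * comp_weight_sum p q \<phi> z"
          proof (rule bloch_seminorm_comp_le_weight[OF h \<phi> im z])
            fix l
            have "(1 - (cmod (\<phi> z $ l))\<^sup>2) powr p \<le> 1"
              using polydisk_one_minus_sq[OF \<phi>z, of l] p by (intro powr_le1) auto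
            with le[of l] show "cmod (cpartial l (?h j) (\<phi> z)) * (1 - (cmod (\<phi> z $ l))\<^sup>2) powr p \<le> \<eta>"
              using mult_mono[of "cmod (cpartial l (?h j) (\<phi> z))" \<eta> "(1 - (cmod (\<phi> z $ l))\<^sup>2) powr p" 1] \<eta>(1)
              by simp
          qed
          also have "\<dots> \<le> \<eta> * M" using M[OF z] \<eta>(1) by (intro mult_left_mono) auto
          finally show ?thesis using \<eta> by simp
        qed
        moreover have "cmod (?h j (\<phi> 0)) \<le> \<epsilon> / 4"
          using elim(2) g_eq(1)[OF \<phi>0] by (simp add: dist_norm)
        ultimately have "bloch_norm q (\<lambda>z. ?h j (\<phi> z)) \<le> \<epsilon> / 4 + \<epsilon> / 3"
          by (intro bloch_norm_le)
        then have "bloch_dist q ((\<sigma> \<circ> \<rho>) j) (?T g) < \<epsilon>"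
          using \<epsilon> by (simp add: f(2) bloch_dist_composition_op[OF \<phi> im fp(1) gp T[OF fp(1)] T[OF gp]])
        then show ?case by (simp add: f(2) T[OF fp(1)])
      qed
    qed
    with gK \<rho> show "\<exists>l r. l \<in> ?T ` K \<and> strict_mono r \<and> limitin Y.mtopology (\<sigma> \<circ> r) l sequentially"
      by blast
  qed
  moreover from this have "closedin Y.mtopology (?T ` K)"
    \<comment> \<open>Compact sets of a metric space are closed, so the closure of the image of
      \<open>B\<close> is a closed subset of a compact set.\<close>
    using compactin_imp_closedin Y.Hausdorff_space_mtopology by blast
  then have "Y.mtopology closure_of (?T ` B) \<subseteq> ?T ` K"
    using BK by (intro closure_of_minimal image_mono)
  ultimately show "compactin Y.mtopology (Y.mtopology closure_of (?T ` B))"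
    using closed_compactin closedin_closure_of by blast
qed

subsection \<open>Compactness on the little Bloch space\<close>

lemma little_bloch_subset: "(little_bloch p :: (complex ^ 'n \<Rightarrow> complex) set) \<subseteq> bloch p"
proof -
  interpret X: Metric_space "bloch p :: (complex ^ 'n \<Rightarrow> complex) set" "bloch_dist p"
    by (rule Metric_space_bloch)
  show ?thesis
    using closure_of_subset_topspace[of X.mtopology "{restrict f polydisk | f. polynomial_cn f}"]
    by (simp add: little_bloch_def)
qed

text \<open>\<open>closure_of\<close> sees only the part of a set that lies in the carrier, hence
  the hypothesis of membership in \<open>bloch p\<close>.\<close>

lemma polynomial_in_little_bloch:
  fixes f :: "complex ^ 'n \<Rightarrow> complex"
  assumes "polynomial_cn f" and f: "restrict f polydisk \<in> bloch p"
  shows "restrict f polydisk \<in> little_bloch p"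
proof -
  interpret X: Metric_space "bloch p :: (complex ^ 'n \<Rightarrow> complex) set" "bloch_dist p"
    by (rule Metric_space_bloch)
  have "restrict f polydisk \<in> topspace X.mtopology \<inter> {restrict f polydisk | f. polynomial_cn f}"
    using assms by auto
  then show ?thesis
    unfolding little_bloch_def using closure_of_subset_Int by fastforce
qed

text \<open>Bounded subsets of the little space are bounded in the whole space. Thus compactness on
  the little space is the weaker alternative, and necessity has to treat only this one.\<close>

lemma compact_operator_little_bloch:
  fixes T :: "(complex ^ 'n \<Rightarrow> complex) \<Rightarrow> 'b"
  assumes "compact_operator (bloch p) (bloch_dist p) Y dY T"
  shows "compact_operator (little_bloch p) (bloch_dist p) Y dY T"
proof -
  interpret X: Metric_space "bloch p :: (complex ^ 'n \<Rightarrow> complex) set" "bloch_dist p"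
    by (rule Metric_space_bloch)
  interpret L: Metric_space "little_bloch p :: (complex ^ 'n \<Rightarrow> complex) set" "bloch_dist p"
    by (rule X.subspace[OF little_bloch_subset])
  have "X.mbounded B" if "L.mbounded B" for B
    using that little_bloch_subset unfolding L.mbounded_alt X.mbounded_alt by blast
  then show ?thesis
    using assms little_bloch_subset unfolding compact_operator_def by blast
qed

lemma bloch_point_evaluation_bound:
  fixes z :: "complex ^ 'n"
  assumes z: "z \<in> polydisk" and p: "0 \<le> p"
  obtains c where "0 < c" "\<And>f. holomorphic_cn f polydisk \<Longrightarrow>
    bdd_above (bloch_seminorm_at p f ` polydisk) \<Longrightarrow> cmod (f z) \<le> c * bloch_norm p f"
proof -
  obtain r where r: "0 \<le> r" "r < 1" "z \<in> closed_polydisk r"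
    using polydisk_in_closed_polydisk[OF z] by metis
  have zero: "0 \<in> closed_polydisk r" using r(1) by (simp add: closed_polydisk_def)
  have r2: "0 < 1 - r\<^sup>2" using r by (simp add: abs_square_less_1)
  let ?c = "1 + norm z / (1 - r\<^sup>2) powr p"
  show thesis
  proof
    show "0 < ?c" by (simp add: add_pos_nonneg)
    fix f :: "complex ^ 'n \<Rightarrow> complex"
    assume f: "holomorphic_cn f polydisk" "bdd_above (bloch_seminorm_at p f ` polydisk)"
    have "cmod (f z) \<le> cmod (f 0) + cmod (f z - f 0)"
      using norm_triangle_ineq[of "f 0" "f z - f 0"] by simp
    also have "\<dots> \<le> bloch_norm p f + bloch_norm p f / (1 - r\<^sup>2) powr p * norm (z - 0)"
      by (intro add_mono bloch_norm_ge(1) f bloch_lipschitz[OF f(1)] bloch_norm_ge(2) r zero p)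
    also have "\<dots> = ?c * bloch_norm p f" by (simp add: algebra_simps)
    finally show "cmod (f z) \<le> ?c * bloch_norm p f" .
  qed
qed

text \<open>Point evaluations are bounded by the Bloch norm. This serves to identify norm limits
  from pointwise limits.\<close>

lemma bloch_limit_pointwise:
  fixes z :: "complex ^ 'n"
  assumes lim: "limitin (Metric_space.mtopology (bloch p) (bloch_dist p)) f g sequentially"
    and p: "0 \<le> p" and z: "z \<in> polydisk"
  shows "(\<lambda>j. f j z) \<longlonglongrightarrow> g z"
proof -
  interpret X: Metric_space "bloch p :: (complex ^ 'n \<Rightarrow> complex) set" "bloch_dist p"
    by (rule Metric_space_bloch)
  obtain c where c: "0 < c" "\<And>f :: complex ^ 'n \<Rightarrow> complex. holomorphic_cn f polydisk \<Longrightarrow>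
    bdd_above (bloch_seminorm_at p f ` polydisk) \<Longrightarrow> cmod (f z) \<le> c * bloch_norm p f"
    by (rule bloch_point_evaluation_bound[OF z p]) blast
  show ?thesis
  proof (rule tendstoI)
    fix e :: real assume e: "0 < e"
    have g: "g \<in> bloch p" using lim X.limitin_mspace by blast
    have "\<forall>\<^sub>F j in sequentially. f j \<in> bloch p \<and> bloch_dist p (f j) g < e / c"
      using lim e c(1) unfolding X.limitin_metric by simp
    then show "\<forall>\<^sub>F j in sequentially. dist (f j z) (g z) < e"
    proof eventually_elim
      case (elim j)
      then have "cmod (f j z - g z) \<le> c * bloch_dist p (f j) g"
        using c(2)[OF bloch_diff[of "f j" p g]] g by (simp add: bloch_dist_def)
      also have "\<dots> < e" using elim c(1) by (simp add: pos_less_divide_eq mult.commute)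
      finally show ?case by (simp add: dist_norm)
    qed
  qed
qed

lemma polynomial_cn_zero: "polynomial_cn (\<lambda>_. 0)"
  unfolding polynomial_cn_def by (intro exI[of _ "{}"]) simp

lemma polynomial_cn_monomial: "polynomial_cn (\<lambda>z. c * (\<Prod>k\<in>UNIV. (z $ k) ^ \<alpha> k))"
  unfolding polynomial_cn_def by (intro exI[of _ "{\<alpha>}"] exI[of _ "\<lambda>_. c"]) simp

text \<open>Otherwise a subsequence has composed seminorms of supremum at least
  \<open>\<epsilon>\<close>. Compactness makes a further subsequence converge in norm; its limit
  must be the pointwise limit 0, a contradiction.\<close>

lemma compact_composition_seminorm_tendsto_zero:
  fixes \<phi> :: "complex ^ 'n \<Rightarrow> complex ^ 'n" and F :: "nat \<Rightarrow> complex ^ 'n \<Rightarrow> complex"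
  assumes comp: "compact_operator (little_bloch p) (bloch_dist p) (bloch q) (bloch_dist q) (composition_op \<phi>)"
    and \<phi>: "\<And>l. holomorphic_cn (\<lambda>z. \<phi> z $ l) polydisk"
    and im: "\<phi> ` polydisk \<subseteq> polydisk" and q: "0 \<le> q"
    and poly: "\<And>N. polynomial_cn (F N)" and hol: "\<And>N. holomorphic_cn (F N) polydisk"
    and C: "\<And>N z. z \<in> polydisk \<Longrightarrow> bloch_seminorm_at p (F N) z \<le> C" and F0: "\<And>N. F N 0 = 0"
    and lim: "\<And>z. z \<in> polydisk \<Longrightarrow> (\<lambda>N. F N z) \<longlonglongrightarrow> 0" and \<epsilon>: "0 < \<epsilon>"
  shows "\<forall>\<^sub>F N in sequentially. \<forall>z\<in>polydisk. bloch_seminorm_at q (\<lambda>z. F N (\<phi> z)) z < \<epsilon>"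
proof (rule ccontr)
  assume "\<not> ?thesis"
  from not_eventually_sequentiallyD[OF this] obtain \<sigma> :: "nat \<Rightarrow> nat"
    where \<sigma>: "strict_mono \<sigma>"
      "\<And>j. \<exists>z\<in>polydisk. \<epsilon> \<le> bloch_seminorm_at q (\<lambda>z. F (\<sigma> j) (\<phi> z)) z"
    by (auto simp: not_less)
  let ?R = "\<lambda>N. restrict (F N) polydisk" and ?T = "composition_op \<phi>"
  let ?O = "restrict (\<lambda>_. 0) polydisk :: complex ^ 'n \<Rightarrow> complex"
  interpret X: Metric_space "bloch p :: (complex ^ 'n \<Rightarrow> complex) set" "bloch_dist p"
    by (rule Metric_space_bloch)
  interpret L: Metric_space "little_bloch p :: (complex ^ 'n \<Rightarrow> complex) set" "bloch_dist p"
    by (rule X.subspace[OF little_bloch_subset])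
  interpret Y: Metric_space "bloch q :: (complex ^ 'n \<Rightarrow> complex) set" "bloch_dist q"
    by (rule Metric_space_bloch)
  have Rb: "?R N \<in> bloch p" for N by (rule restrict_in_bloch[OF hol C])
  have Rl: "?R N \<in> little_bloch p" for N by (rule polynomial_in_little_bloch[OF poly Rb])
  have Ol: "?O \<in> little_bloch p" by (rule polynomial_in_little_bloch[OF polynomial_cn_zero zero_in_bloch])
  have "bloch_dist p ?O (?R N) \<le> C" for N
  proof -
    have "bloch_dist p ?O (?R N) = bloch_norm p (?R N)"
      using bloch_dist_zero[OF Rb] X.commute by metis
    also have "\<dots> = bloch_norm p (F N)"
      by (rule bloch_norm_transform[OF hol]) simp
    also have "\<dots> \<le> 0 + C" by (rule bloch_norm_le) (use C F0 in auto)
    finally show ?thesis by simp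
  qed
  then have "L.mbounded (range ?R)"
    unfolding L.mbounded using Rl Ol by blast
  \<comment> \<open>Both facts carry the premise on \<open>f\<close>; for \<open>cpt\<close> it is
    discharged later by the zero function.\<close>
  then have cpt: "compactin Y.mtopology (Y.mtopology closure_of (?T ` range ?R))"
    and TY: "?T f \<in> bloch q" if "f \<in> little_bloch p" for f
    using comp that unfolding compact_operator_def by blast+
  have "?T ` range ?R \<subseteq> Y.mtopology closure_of (?T ` range ?R)"
    using TY Rl by (intro closure_of_subset) auto
  then have "range (\<lambda>j. ?T (?R (\<sigma> j))) \<subseteq> Y.mtopology closure_of (?T ` range ?R)"
    by blast
  then obtain g and \<rho> :: "nat \<Rightarrow> nat" where \<rho>: "strict_mono \<rho>"
    and g: "limitin Y.mtopology ((\<lambda>j. ?T (?R (\<sigma> j))) \<circ> \<rho>) g sequentially"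
    using cpt[OF Ol] unfolding Y.compactin_sequentially by blast
  have T_eq: "?T (?R N) z = F N (\<phi> z)" if "z \<in> polydisk" for N z
    using that im by (auto simp: composition_op_def compose_def)
  have gY: "g \<in> bloch q" using g Y.limitin_mspace by blast
  have "g z = 0" if z: "z \<in> polydisk" for z
  proof (rule LIMSEQ_unique)
    show "(\<lambda>j. ((\<lambda>j. ?T (?R (\<sigma> j))) \<circ> \<rho>) j z) \<longlonglongrightarrow> g z"
      by (rule bloch_limit_pointwise[OF g q z])
    have "(\<lambda>N. F N (\<phi> z)) \<longlonglongrightarrow> 0" using lim im z by blast
    from LIMSEQ_subseq_LIMSEQ[OF this strict_mono_o[OF \<sigma>(1) \<rho>]]
    show "(\<lambda>j. ((\<lambda>j. ?T (?R (\<sigma> j))) \<circ> \<rho>) j z) \<longlonglongrightarrow> 0"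
      using T_eq[OF z] by (simp add: o_def)
  qed
  moreover obtain j where j: "bloch_dist q (?T (?R (\<sigma> (\<rho> j)))) g < \<epsilon>"
    using g \<epsilon> unfolding Y.limit_metric_sequentially by auto
  moreover have "holomorphic_cn (\<lambda>z. F (\<sigma> (\<rho> j)) (\<phi> z)) polydisk"
    by (rule holomorphic_cnI[OF holomorphic_cn_compose_has_derivative[OF hol \<phi> im]])
  moreover obtain z where z: "z \<in> polydisk" "\<epsilon> \<le> bloch_seminorm_at q (\<lambda>z. F (\<sigma> (\<rho> j)) (\<phi> z)) z"
    using \<sigma>(2) by blast
  \<comment> \<open>Since \<open>g\<close> vanishes on the polydisk, the distance to
    \<open>g\<close> dominates the seminorm that was chosen large.\<close>
  ultimately have "bloch_seminorm_at q (\<lambda>z. ?T (?R (\<sigma> (\<rho> j))) z - g z) z = bloch_seminorm_at q (\<lambda>z. F (\<sigma> (\<rho> j)) (\<phi> z)) z"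
    by (intro bloch_seminorm_at_transform) (simp_all add: T_eq)
  moreover have "bloch_seminorm_at q (\<lambda>z. ?T (?R (\<sigma> (\<rho> j))) z - g z) z \<le> bloch_dist q (?T (?R (\<sigma> (\<rho> j)))) g"
    using bloch_norm_ge(2)[OF bloch_diff(2)[OF TY[OF Rl] gY] z(1)] TY[OF Rl] gY by (simp add: bloch_dist_def)
  ultimately show False using z(2) j by linarith
qed

subsection \<open>Necessity of the weight condition\<close>

text \<open>From \<open>r \<le> exp (- (1 - r))\<close> the power \<open>r ^ N\<close> is at most a
  \<open>p\<close>-th power of an exponential, which beats the linear factor \<open>Suc N\<close>.
  The bound is uniform in \<open>N\<close> and \<open>r\<close>, so the test polynomials form
  bounded families.\<close>

lemma power_weight_bound:
  fixes p r :: real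
  assumes p: "0 < p" and r: "0 \<le> r" "r < 1"
  shows "real (Suc N) powr p * r ^ N * (1 - r\<^sup>2) powr p \<le> (2 * (1 + p)) powr p"
proof -
  \<comment> \<open>This choice turns the whole product into a single \<open>p\<close>-th
    power.\<close>
  define s where "s = real N / p"
  have N: "real N = p * s" and s: "0 \<le> s" using p by (simp_all add: s_def)
  have "r \<le> exp (- (1 - r))" using exp_ge_add_one_self[of "- (1 - r)"] by simp
  then have "r ^ N \<le> exp (- (1 - r)) ^ N" using r(1) by (rule power_mono)
  also have "\<dots> = exp (- (s * (1 - r))) powr p"
    by (simp add: exp_of_nat_mult[symmetric] powr_def N algebra_simps)
  finally have rN: "r ^ N \<le> exp (- (s * (1 - r))) powr p" .
  have "1 - r\<^sup>2 = (1 + r) * (1 - r)" by (simp add: algebra_simps power2_eq_square)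
  also have "\<dots> \<le> 2 * (1 - r)" using r by (intro mult_right_mono) auto
  finally have r2: "1 - r\<^sup>2 \<le> 2 * (1 - r)" .
  have r20: "0 \<le> 1 - r\<^sup>2" using r by (simp add: abs_square_le_1)
  have "real (Suc N) * (1 - r) = (1 - r) + p * (s * (1 - r))" by (simp add: N algebra_simps)
  also have "\<dots> \<le> (1 + p) * (1 + s * (1 - r))"
  proof -
    have "(1 - r) + p * x \<le> (1 + p) * (1 + x)" if "0 \<le> x" for x
      using that r p by (simp add: algebra_simps)
    then show ?thesis using r s by simp
  qed
  also have "\<dots> \<le> (1 + p) * exp (s * (1 - r))"
    using p by (intro mult_left_mono exp_ge_add_one_self) auto
  finally have "real (Suc N) * (1 - r) * exp (- (s * (1 - r))) \<le> 1 + p"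
    by (simp add: exp_minus divide_simps)
  then have "2 * (real (Suc N) * (1 - r) * exp (- (s * (1 - r)))) \<le> 2 * (1 + p)"
    by (rule mult_left_mono) simp
  then have *: "real (Suc N) * exp (- (s * (1 - r))) * (2 * (1 - r)) \<le> 2 * (1 + p)"
    by (simp only: mult_ac)
  have "real (Suc N) powr p * r ^ N * (1 - r\<^sup>2) powr p
      \<le> real (Suc N) powr p * exp (- (s * (1 - r))) powr p * (2 * (1 - r)) powr p"
    using r2 r20 p r by (intro mult_mono mult_left_mono rN powr_mono2 mult_nonneg_nonneg) auto
  also have "\<dots> = (real (Suc N) * exp (- (s * (1 - r))) * (2 * (1 - r))) powr p"
    using r by (simp add: powr_mult)
  also have "\<dots> \<le> (2 * (1 + p)) powr p"
    using * p r by (intro powr_mono2) auto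
  finally show ?thesis .
qed

text \<open>With \<open>N\<close> the integer part of \<open>1 / (1 - a)\<close> the power
  \<open>a ^ N\<close> stays away from 0, because \<open>1 - t \<ge> exp (- 2 * t)\<close> for
  \<open>0 \<le> t \<le> 1 / 2\<close>.\<close>

lemma power_lower_bound:
  fixes a :: real
  assumes a: "1 / 2 \<le> a" "a < 1"
  obtains N where "1 / (1 - a) \<le> real (Suc N)" "exp (- 2) \<le> a ^ N"
proof
  define t where "t = 1 - a"
  have t: "0 < t" "t \<le> 1 / 2" using a by (auto simp: t_def)
  define N where "N = nat \<lfloor>1 / t\<rfloor>"
  have N: "real N \<le> 1 / t" "1 / t \<le> real N + 1"
    using t unfolding N_def by (auto simp: of_nat_floor)
  show "1 / (1 - a) \<le> real (Suc N)" using N(2) by (simp add: t_def)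
  have "t * t \<le> t * (1 / 2)" using t by (intro mult_left_mono) auto
  then have "1 \<le> (1 + 2 * t) * (1 - t)" by (simp add: algebra_simps)
  also have "\<dots> \<le> exp (2 * t) * (1 - t)"
    using t by (intro mult_right_mono exp_ge_add_one_self) auto
  finally have "exp (- (2 * t)) \<le> 1 - t" by (simp add: exp_minus divide_simps mult.commute)
  then have "exp (- (2 * t)) ^ N \<le> a ^ N" by (intro power_mono) (auto simp: t_def)
  moreover have "exp (- 2) \<le> exp (- (2 * t)) ^ N"
    using N(1) t by (simp add: exp_of_nat_mult[symmetric] pos_le_divide_eq mult.commute)
  ultimately show "exp (- 2) \<le> a ^ N" by linarith
qed

text \<open>Grouped by components, the weight sum consists of quotients that can be tested one
  \<open>l\<close> at a time.\<close>

lemma comp_weight_sum_eq: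
  "comp_weight_sum p q \<phi> z =
    (\<Sum>l\<in>UNIV. bloch_seminorm_at q (\<lambda>w. \<phi> w $ l) z / (1 - (cmod (\<phi> z $ l))\<^sup>2) powr p)"
  unfolding comp_weight_sum_def bloch_seminorm_at_def sum_divide_distrib
  by (subst sum.swap) simp

lemma bloch_seminorm_le_weight:
  assumes "\<phi> ` polydisk \<subseteq> polydisk" "z \<in> polydisk" "0 \<le> p"
  shows "bloch_seminorm_at q (\<lambda>w. \<phi> w $ l) z \<le>
    bloch_seminorm_at q (\<lambda>w. \<phi> w $ l) z / (1 - (cmod (\<phi> z $ l))\<^sup>2) powr p"
proof -
  have "\<phi> z \<in> polydisk" using assms by blast
  from polydisk_one_minus_sq[OF this, of l] assms(3)
  have "(1 - (cmod (\<phi> z $ l))\<^sup>2) powr p \<le> 1" "0 < (1 - (cmod (\<phi> z $ l))\<^sup>2) powr p"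
    by (auto intro: powr_le1)
  then show ?thesis
    using bloch_seminorm_at_nonneg[of q "\<lambda>w. \<phi> w $ l" z] by (simp add: pos_le_divide_eq mult_left_le)
qed

text \<open>For fixed \<open>w\<close> the product of \<open>real (Suc N) powr p\<close> and
  \<open>cmod w ^ N\<close> is bounded, so the smaller exponent \<open>p - 1\<close> leaves a factor
  \<open>1 / Suc N\<close>.\<close>

lemma of_nat_power_tendsto_zero:
  fixes w :: complex
  assumes p: "0 < p" and w: "cmod w < 1"
  shows "(\<lambda>N. of_real (real (Suc N) powr (p - 1)) * w ^ Suc N) \<longlonglongrightarrow> 0"
proof (rule Lim_null_comparison)
  let ?r = "cmod w"
  let ?c = "(2 * (1 + p)) powr p / (1 - ?r\<^sup>2) powr p"
  have r2: "0 < (1 - ?r\<^sup>2) powr p" using w abs_square_less_1[of ?r] by simp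
  show "\<forall>\<^sub>F N in sequentially. norm (of_real (real (Suc N) powr (p - 1)) * w ^ Suc N) \<le> ?c * inverse (real (Suc N))"
  proof (rule always_eventually, rule allI)
    fix N
    have "real (Suc N) powr p * ?r ^ N \<le> ?c"
      using power_weight_bound[OF p norm_ge_zero w, of N] r2 by (simp add: pos_le_divide_eq)
    then have "real (Suc N) powr p * ?r ^ N * inverse (real (Suc N)) \<le> ?c * inverse (real (Suc N))"
      by (rule mult_right_mono) simp
    moreover have "norm (of_real (real (Suc N) powr (p - 1)) * w ^ Suc N) = real (Suc N) powr (p - 1) * (?r * ?r ^ N)"
      by (simp only: norm_mult norm_of_real norm_power power_Suc abs_of_nonneg powr_ge_zero)
    moreover have "\<dots> \<le> real (Suc N) powr (p - 1) * ?r ^ N"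
      using w by (intro mult_left_mono mult_left_le_one_le) auto
    moreover have "\<dots> = real (Suc N) powr p * ?r ^ N * inverse (real (Suc N))"
      by (simp add: powr_diff divide_inverse del: of_nat_Suc)
    ultimately show "norm (of_real (real (Suc N) powr (p - 1)) * w ^ Suc N) \<le> ?c * inverse (real (Suc N))"
      by linarith
  qed
  show "(\<lambda>N. ?c * inverse (real (Suc N))) \<longlonglongrightarrow> 0"
    by (rule tendsto_mult_right_zero[OF LIMSEQ_inverse_real_of_nat])
qed

section \<open>The test polynomials and their partial derivatives\<close>

lemma coordinate_power:
  fixes l :: "'n :: finite"
  shows "polynomial_cn (\<lambda>z :: complex ^ 'n. c * (z $ l) ^ Suc N)" (is ?poly)
    and "holomorphic_cn (\<lambda>z :: complex ^ 'n. c * (z $ l) ^ Suc N) S" (is ?hol)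
    and "cpartial m (\<lambda>z :: complex ^ 'n. c * (z $ l) ^ Suc N) z =
      (if m = l then c * of_nat (Suc N) * (z $ l) ^ N else 0)" (is ?cp)
proof -
  have "(\<Prod>k\<in>UNIV. (z $ k) ^ (if k = l then Suc N else 0)) = (\<Prod>k\<in>UNIV. if k = l then (z $ l) ^ Suc N else 1)"
    for z :: "complex ^ 'n"
    by (intro prod.cong) auto
  then have "(\<Prod>k\<in>UNIV. (z $ k) ^ (if k = l then Suc N else 0)) = (z $ l) ^ Suc N" for z :: "complex ^ 'n"
    by simp
  then show ?poly
    using polynomial_cn_monomial[of c "\<lambda>k. if k = l then Suc N else 0"] by simp
  \<comment> \<open>With exponent \<open>Suc N\<close> the polynomial vanishes at 0 and its
    derivative has the exponent \<open>N\<close>.\<close>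
  have D: "((\<lambda>z :: complex ^ 'n. c * (z $ l) ^ Suc N) has_derivative
      (\<lambda>v. \<Sum>k\<in>UNIV. (if k = l then c * of_nat (Suc N) * (z $ l) ^ N else 0) * v $ k)) (at z)" for z
  proof -
    have nth: "((\<lambda>z :: complex ^ 'n. z $ l) has_derivative (\<lambda>v. v $ l)) (at z)"
      by (rule bounded_linear_imp_has_derivative[OF bounded_linear_vec_nth])
    have "((\<lambda>z :: complex ^ 'n. c * (z $ l) ^ Suc N) has_derivative
        (\<lambda>v. c * (of_nat (Suc N) * v $ l * (z $ l) ^ N))) (at z)"
      using has_derivative_mult_right[OF has_derivative_power[OF nth, of "Suc N"], of c] by simp
    moreover have "(\<Sum>k\<in>UNIV. (if k = l then c * of_nat (Suc N) * (z $ l) ^ N else 0) * v $ k)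
        = (\<Sum>k\<in>UNIV. if k = l then c * of_nat (Suc N) * (z $ l) ^ N * v $ l else 0)" for v :: "complex ^ 'n"
      by (intro sum.cong) auto
    ultimately show ?thesis by (simp add: mult_ac)
  qed
  show ?hol using D by (rule holomorphic_cnI)
  show ?cp by (rule cpartial_eqI[OF D])
qed

lemma coordinate_product:
  fixes l l' :: "'n :: finite"
  assumes l: "l \<noteq> l'"
  shows "polynomial_cn (\<lambda>z :: complex ^ 'n. (z $ l') ^ Suc N * z $ l)" (is ?poly)
    and "holomorphic_cn (\<lambda>z :: complex ^ 'n. (z $ l') ^ Suc N * z $ l) S" (is ?hol)
    and "cpartial m (\<lambda>z :: complex ^ 'n. (z $ l') ^ Suc N * z $ l) z =
      (if m = l then (z $ l') ^ Suc N else if m = l' then of_nat (Suc N) * (z $ l') ^ N * z $ l else 0)" (is ?cp)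
proof -
  have two: "(\<Sum>k\<in>(UNIV :: 'n set). if k = l then A else if k = l' then B else 0) = A + B" for A B :: complex
    using l by (simp add: if_distrib sum.If_cases[of UNIV "\<lambda>k. k = l", simplified] Int_def)
  have "(\<Prod>k\<in>UNIV. (z $ k) ^ (if k = l then 1 else if k = l' then Suc N else 0))
      = (\<Prod>k\<in>UNIV. (if k = l' then (z $ l') ^ Suc N else 1) * (if k = l then z $ l else 1))"
    for z :: "complex ^ 'n"
    using l by (intro prod.cong) auto
  then have "(\<Prod>k\<in>UNIV. (z $ k) ^ (if k = l then 1 else if k = l' then Suc N else 0)) = (z $ l') ^ Suc N * z $ l"
    for z :: "complex ^ 'n"
    by (simp add: prod.distrib)
  then show ?poly
    using polynomial_cn_monomial[of 1 "\<lambda>k. if k = l then 1 else if k = l' then Suc N else 0"] by simp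
  have D: "((\<lambda>z :: complex ^ 'n. (z $ l') ^ Suc N * z $ l) has_derivative
      (\<lambda>v. \<Sum>k\<in>UNIV. (if k = l then (z $ l') ^ Suc N
        else if k = l' then of_nat (Suc N) * (z $ l') ^ N * z $ l else 0) * v $ k)) (at z)" for z
  proof -
    have nth: "((\<lambda>z :: complex ^ 'n. z $ j) has_derivative (\<lambda>v. v $ j)) (at z)" for j
      by (rule bounded_linear_imp_has_derivative[OF bounded_linear_vec_nth])
    have "((\<lambda>z :: complex ^ 'n. (z $ l') ^ Suc N * z $ l) has_derivative
        (\<lambda>v. (z $ l') ^ Suc N * v $ l + of_nat (Suc N) * v $ l' * (z $ l') ^ N * z $ l)) (at z)"
      using has_derivative_mult[OF has_derivative_power[OF nth[of l'], of "Suc N"] nth[of l]] by simp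
    moreover have "(\<Sum>k\<in>UNIV. (if k = l then (z $ l') ^ Suc N
        else if k = l' then of_nat (Suc N) * (z $ l') ^ N * z $ l else 0) * v $ k)
        = (\<Sum>k\<in>UNIV. if k = l then (z $ l') ^ Suc N * v $ l
        else if k = l' then of_nat (Suc N) * (z $ l') ^ N * z $ l * v $ l' else 0)" for v :: "complex ^ 'n"
      by (intro sum.cong) auto
    ultimately show ?thesis by (simp add: two mult_ac)
  qed
  show ?hol using D by (rule holomorphic_cnI)
  show ?cp by (rule cpartial_eqI[OF D])
qed

text \<open>For the test polynomials \<open>?F N\<close> the composed seminorm at \<open>z\<close>
  is \<open>real (Suc N) powr p * ?a ^ N * ?V\<close>. When \<open>N\<close> is about
  \<open>1 / (1 - ?a)\<close>, this dominates the quotient in question up to the factor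
  \<open>exp (- 2)\<close>.\<close>

lemma compact_imp_weight_vanishes_same:
  fixes \<phi> :: "complex ^ 'n \<Rightarrow> complex ^ 'n"
  assumes comp: "compact_operator (little_bloch p) (bloch_dist p) (bloch q) (bloch_dist q) (composition_op \<phi>)"
    and \<phi>: "\<And>l. holomorphic_cn (\<lambda>z. \<phi> z $ l) polydisk"
    and im: "\<phi> ` polydisk \<subseteq> polydisk" and p: "0 < p" and q: "0 \<le> q" and \<epsilon>: "0 < \<epsilon>"
  obtains \<delta> where "0 < \<delta>" "\<And>z. z \<in> polydisk \<Longrightarrow> 1 - \<delta> < cmod (\<phi> z $ l) \<Longrightarrow>
    bloch_seminorm_at q (\<lambda>w. \<phi> w $ l) z / (1 - (cmod (\<phi> z $ l))\<^sup>2) powr p < \<epsilon>"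
proof -
  let ?c = "\<lambda>N. complex_of_real (real (Suc N) powr (p - 1))"
  let ?F = "\<lambda>N z :: complex ^ 'n. ?c N * (z $ l) ^ Suc N"
  have cp: "cpartial m (?F N) z = (if m = l then of_real (real (Suc N) powr p) * (z $ l) ^ N else 0)" for m N z
  proof -
    have "real (Suc N) powr (p - 1) * real (Suc N) = real (Suc N) powr p"
      by (simp add: powr_diff del: of_nat_Suc)
    then have "?c N * of_nat (Suc N) = of_real (real (Suc N) powr p)"
      by (metis of_real_mult of_real_of_nat_eq)
    then show ?thesis by (simp add: coordinate_power(3) del: of_nat_Suc power_Suc)
  qed
  have "\<forall>\<^sub>F N in sequentially. \<forall>z\<in>polydisk. bloch_seminorm_at q (\<lambda>z. ?F N (\<phi> z)) z < \<epsilon> * exp (- 2)"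
  proof (rule compact_composition_seminorm_tendsto_zero[OF comp \<phi> im q coordinate_power(1,2)])
    fix N and z :: "complex ^ 'n" assume z: "z \<in> polydisk"
    have zl: "cmod (z $ l) < 1" using z by (simp add: polydisk_def)
    have "bloch_seminorm_at p (?F N) z = (\<Sum>k\<in>UNIV. if k = l then
        real (Suc N) powr p * cmod (z $ l) ^ N * (1 - (cmod (z $ l))\<^sup>2) powr p else 0)"
      unfolding bloch_seminorm_at_def cp
      by (intro sum.cong) (auto simp: norm_mult norm_power simp del: of_nat_Suc)
    then show "bloch_seminorm_at p (?F N) z \<le> (2 * (1 + p)) powr p"
      using power_weight_bound[OF p norm_ge_zero zl, of N] by (simp del: of_nat_Suc)
  next
    fix z :: "complex ^ 'n" assume z: "z \<in> polydisk"
    show "(\<lambda>N. ?F N z) \<longlonglongrightarrow> 0"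
      by (rule of_nat_power_tendsto_zero[OF p]) (use z in \<open>simp add: polydisk_def\<close>)
  qed (use \<epsilon> in simp_all)
  then obtain N0 where N0: "\<And>N z. N0 \<le> N \<Longrightarrow> z \<in> polydisk \<Longrightarrow>
      bloch_seminorm_at q (\<lambda>z. ?F N (\<phi> z)) z < \<epsilon> * exp (- 2)"
    unfolding eventually_sequentially by blast
  show thesis
  proof
    \<comment> \<open>This forces \<open>?a \<ge> 1 / 2\<close>, as the choice of \<open>N\<close>
      requires, and makes \<open>1 / (1 - ?a)\<close> exceed \<open>N0 + 2\<close>, so that
      \<open>N \<ge> N0\<close>.\<close>
    let ?\<delta> = "1 / real (N0 + 2)"
    show "0 < ?\<delta>" by simp
    fix z assume z: "z \<in> polydisk" and near: "1 - ?\<delta> < cmod (\<phi> z $ l)"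
    let ?a = "cmod (\<phi> z $ l)" and ?V = "bloch_seminorm_at q (\<lambda>w. \<phi> w $ l) z"
    have \<phi>z: "\<phi> z \<in> polydisk" using im z by blast
    then have a1: "?a < 1" by (simp add: polydisk_def)
    have "?\<delta> \<le> 1 / 2" by (simp add: field_simps)
    with near have a2: "1 / 2 \<le> ?a" by linarith
    obtain N where N: "1 / (1 - ?a) \<le> real (Suc N)" "exp (- 2) \<le> ?a ^ N"
      by (rule power_lower_bound[OF a2 a1])
    have "real (N0 + 2) < 1 / (1 - ?a)"
      using near a1 by (simp add: field_simps)
    with N(1) have "N0 \<le> N" by linarith
    have "bloch_seminorm_at q (\<lambda>z. ?F N (\<phi> z)) z = real (Suc N) powr p * ?a ^ N * ?V"
    proof -
      have "cpartial k (\<lambda>z. ?F N (\<phi> z)) z = of_real (real (Suc N) powr p) * (\<phi> z $ l) ^ N * cpartial k (\<lambda>w. \<phi> w $ l) z" for k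
      proof -
        have "cpartial k (\<lambda>z. ?F N (\<phi> z)) z = (\<Sum>m\<in>UNIV. cpartial m (?F N) (\<phi> z) * cpartial k (\<lambda>w. \<phi> w $ m) z)"
          by (rule cpartial_eqI[OF holomorphic_cn_compose_has_derivative[OF coordinate_power(2)[of _ l N polydisk] \<phi> im z]])
        also have "\<dots> = (\<Sum>m\<in>UNIV. if m = l then
            of_real (real (Suc N) powr p) * (\<phi> z $ l) ^ N * cpartial k (\<lambda>w. \<phi> w $ l) z else 0)"
          unfolding cp by (intro sum.cong) auto
        finally show ?thesis by simp
      qed
      then show ?thesis
        by (simp add: bloch_seminorm_at_def norm_mult norm_power sum_distrib_left mult.assoc del: of_nat_Suc)
    qed
    moreover have "bloch_seminorm_at q (\<lambda>z. ?F N (\<phi> z)) z < \<epsilon> * exp (- 2)"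
      by (rule N0[OF \<open>N0 \<le> N\<close> z])
    moreover have "exp (- 2) * (?V / (1 - ?a\<^sup>2) powr p) \<le> real (Suc N) powr p * ?a ^ N * ?V"
    proof -
      have "1 - ?a \<le> 1 - ?a\<^sup>2" using a1 by (simp add: power2_eq_square mult_left_le)
      then have "1 / (1 - ?a\<^sup>2) \<le> 1 / (1 - ?a)" using a1 by (intro divide_left_mono) (auto intro!: mult_pos_pos)
      with N(1) have "1 / (1 - ?a\<^sup>2) \<le> real (Suc N)" by linarith
      then have "(1 / (1 - ?a\<^sup>2)) powr p \<le> real (Suc N) powr p"
        using polydisk_one_minus_sq[OF \<phi>z, of l] p by (intro powr_mono2) auto
      then have "1 / (1 - ?a\<^sup>2) powr p \<le> real (Suc N) powr p"
        using polydisk_one_minus_sq[OF \<phi>z, of l] by (simp add: powr_divide del: of_nat_Suc)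
      then have "1 / (1 - ?a\<^sup>2) powr p * exp (- 2) * ?V \<le> real (Suc N) powr p * ?a ^ N * ?V"
        by (intro mult_right_mono mult_mono N(2) bloch_seminorm_at_nonneg) auto
      then show ?thesis by (simp add: mult_ac)
    qed
    ultimately have "exp (- 2) * (?V / (1 - ?a\<^sup>2) powr p) < exp (- 2) * \<epsilon>"
      by (simp only: mult.commute)
    then show "?V / (1 - ?a\<^sup>2) powr p < \<epsilon>" by (rule mult_left_less_imp_less) simp
  qed
qed

text \<open>For \<open>l \<noteq> l'\<close> there are two cases. If \<open>\<phi> z $ l\<close> is
  also near the circle, the previous lemma applies. Otherwise its denominator is bounded below, and
  it suffices that the numerator is small, which the product polynomials \<open>?G N\<close>
  show.\<close>

lemma compact_imp_weight_vanishes: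
  fixes \<phi> :: "complex ^ 'n \<Rightarrow> complex ^ 'n"
  assumes comp: "compact_operator (little_bloch p) (bloch_dist p) (bloch q) (bloch_dist q) (composition_op \<phi>)"
    and \<phi>: "\<And>l. holomorphic_cn (\<lambda>z. \<phi> z $ l) polydisk"
    and im: "\<phi> ` polydisk \<subseteq> polydisk" and p: "1 \<le> p" and q: "0 \<le> q" and \<epsilon>: "0 < \<epsilon>"
  shows "\<exists>\<delta>>0. \<forall>z\<in>polydisk. 1 - \<delta> < cmod (\<phi> z $ l') \<longrightarrow>
    bloch_seminorm_at q (\<lambda>w. \<phi> w $ l) z / (1 - (cmod (\<phi> z $ l))\<^sup>2) powr p < \<epsilon>"
proof (cases "l = l'")
  case True
  have "0 < p" using p by simp
  from compact_imp_weight_vanishes_same[OF comp \<phi> im this q \<epsilon>, of l] True show ?thesis by metis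
next
  case False
  have p0: "0 < p" using p by simp
  obtain \<delta>1 where \<delta>1: "0 < \<delta>1" "\<And>z. z \<in> polydisk \<Longrightarrow> 1 - \<delta>1 < cmod (\<phi> z $ l) \<Longrightarrow>
      bloch_seminorm_at q (\<lambda>w. \<phi> w $ l) z / (1 - (cmod (\<phi> z $ l))\<^sup>2) powr p < \<epsilon>"
    by (rule compact_imp_weight_vanishes_same[OF comp \<phi> im p0 q \<epsilon>, of l]) blast
  define d where "d = min \<delta>1 1"
  have d: "0 < d" "d \<le> 1" "d \<le> \<delta>1" using \<delta>1(1) by (auto simp: d_def)
  \<comment> \<open>Below, \<open>exp (- 2) / 2\<close> times the numerator is less than
    \<open>5 * \<mu>\<close>, while \<open>d powr p\<close> bounds the denominator from
    below.\<close>
  define \<mu> where "\<mu> = \<epsilon> * exp (- 2) * d powr p / 10"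
  have \<mu>: "0 < \<mu>" using \<epsilon> d by (simp add: \<mu>_def)
  obtain \<delta>2 where \<delta>2: "0 < \<delta>2" "\<And>z. z \<in> polydisk \<Longrightarrow> 1 - \<delta>2 < cmod (\<phi> z $ l') \<Longrightarrow>
      bloch_seminorm_at q (\<lambda>w. \<phi> w $ l') z / (1 - (cmod (\<phi> z $ l'))\<^sup>2) powr p < \<mu>"
    by (rule compact_imp_weight_vanishes_same[OF comp \<phi> im p0 q \<mu>, of l']) blast
  \<comment> \<open>The partial derivative in direction \<open>l'\<close> could cancel the one in direction \<open>l\<close>; its contribution
    is controlled by \<open>\<delta>2\<close>.\<close>
  let ?G = "\<lambda>N z :: complex ^ 'n. (z $ l') ^ Suc N * z $ l"
  note G = coordinate_product[OF False]
  \<comment> \<open>The power estimate with exponent 1, where the constant is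
    \<open>2 * (1 + 1)\<close>.\<close>
  have G_bound: "real (Suc N) * cmod (z $ l') ^ N * (1 - (cmod (z $ l'))\<^sup>2) \<le> 4" if "z \<in> polydisk" for z :: "complex ^ 'n" and N
  proof -
    have "cmod (z $ l') < 1" using that by (simp add: polydisk_def)
    from power_weight_bound[of 1, OF _ norm_ge_zero this, of N] polydisk_one_minus_sq(1)[OF that, of l']
    show ?thesis by (simp del: of_nat_Suc)
  qed
  have "\<forall>\<^sub>F N in sequentially. \<forall>z\<in>polydisk. bloch_seminorm_at q (\<lambda>z. ?G N (\<phi> z)) z < \<mu>"
  proof (rule compact_composition_seminorm_tendsto_zero[OF comp \<phi> im q G(1,2)])
    fix N and z :: "complex ^ 'n" assume z: "z \<in> polydisk"
    have lt: "cmod (z $ k) \<le> 1" for k using z by (simp add: polydisk_def less_imp_le)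
    \<comment> \<open>\<open>w2\<close> uses \<open>p \<ge> 1\<close>: it reduces the weight to the
      first power, so \<open>G_bound\<close> applies and the \<open>?G N\<close> are
      bounded.\<close>
    have w1: "(1 - (cmod (z $ k))\<^sup>2) powr p \<le> 1" and w2: "(1 - (cmod (z $ k))\<^sup>2) powr p \<le> 1 - (cmod (z $ k))\<^sup>2" for k
      using polydisk_one_minus_sq[OF z, of k] p powr_mono'[of 1 p "1 - (cmod (z $ k))\<^sup>2"]
      by (auto intro: powr_le1)
    have "bloch_seminorm_at p (?G N) z \<le> (\<Sum>k\<in>UNIV. (if k = l then 1 else 0) + (if k = l' then 4 else 0))"
      unfolding bloch_seminorm_at_def
    proof (rule sum_mono)
      fix k
      have "cmod (z $ l') ^ Suc N * (1 - (cmod (z $ l))\<^sup>2) powr p \<le> 1 * 1"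
        by (intro mult_mono power_le_one w1 lt) auto
      moreover have "real (Suc N) * cmod (z $ l') ^ N * cmod (z $ l) * (1 - (cmod (z $ l'))\<^sup>2) powr p \<le> 4"
      proof -
        have "real (Suc N) * cmod (z $ l') ^ N * cmod (z $ l) * (1 - (cmod (z $ l'))\<^sup>2) powr p
            \<le> real (Suc N) * cmod (z $ l') ^ N * 1 * (1 - (cmod (z $ l'))\<^sup>2)"
          by (intro mult_mono mult_left_mono w2 lt) auto
        with G_bound[OF z, of N] show ?thesis by linarith
      qed
      ultimately show "cmod (cpartial k (?G N) z) * (1 - (cmod (z $ k))\<^sup>2) powr p
          \<le> (if k = l then 1 else 0) + (if k = l' then 4 else 0)"
        using False by (auto simp: G(3) norm_mult norm_power simp del: of_nat_Suc power_Suc)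
    qed
    also have "\<dots> = 5" by (simp add: sum.distrib)
    finally show "bloch_seminorm_at p (?G N) z \<le> 5" .
  next
    fix z :: "complex ^ 'n" assume z: "z \<in> polydisk"
    have "cmod (z $ l') < 1" using z by (simp add: polydisk_def)
    then have "(\<lambda>N. (z $ l') ^ Suc N) \<longlonglongrightarrow> 0" by (intro LIMSEQ_Suc LIMSEQ_power_zero)
    from tendsto_mult_left_zero[OF this] show "(\<lambda>N. ?G N z) \<longlonglongrightarrow> 0" .
  qed (use \<mu> in simp_all)
  then obtain N0 where N0: "\<And>N z. N0 \<le> N \<Longrightarrow> z \<in> polydisk \<Longrightarrow>
      bloch_seminorm_at q (\<lambda>z. ?G N (\<phi> z)) z < \<mu>"
    unfolding eventually_sequentially by blast
  define \<delta> where "\<delta> = min \<delta>2 (1 / real (N0 + 2))"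
  have "bloch_seminorm_at q (\<lambda>w. \<phi> w $ l) z / (1 - (cmod (\<phi> z $ l))\<^sup>2) powr p < \<epsilon>"
    if z: "z \<in> polydisk" and near: "1 - \<delta> < cmod (\<phi> z $ l')" for z
  proof (cases "1 - \<delta>1 < cmod (\<phi> z $ l)")
    case True
    then show ?thesis by (rule \<delta>1(2)[OF z])
  next
    case far: False
    let ?a = "cmod (\<phi> z $ l)" and ?b = "cmod (\<phi> z $ l')"
    let ?V = "bloch_seminorm_at q (\<lambda>w. \<phi> w $ l) z" and ?V' = "bloch_seminorm_at q (\<lambda>w. \<phi> w $ l') z"
    have \<phi>z: "\<phi> z \<in> polydisk" using im z by blast
    then have a1: "?a < 1" and b1: "?b < 1" by (auto simp: polydisk_def)
    have b_near: "1 - 1 / real (N0 + 2) < ?b" "1 - \<delta>2 < ?b" using near by (auto simp: \<delta>_def)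
    have "1 / real (N0 + 2) \<le> 1 / 2" by (simp add: field_simps)
    with b_near have b2: "1 / 2 \<le> ?b" by linarith
    obtain N where N: "1 / (1 - ?b) \<le> real (Suc N)" "exp (- 2) \<le> ?b ^ N"
      by (rule power_lower_bound[OF b2 b1])
    have "real (N0 + 2) < 1 / (1 - ?b)"
      using b_near(1) b1 by (simp add: field_simps)
    with N(1) have "N0 \<le> N" by linarith
    let ?x = "(\<phi> z $ l') ^ Suc N" and ?y = "of_nat (Suc N) * (\<phi> z $ l') ^ N * \<phi> z $ l"
    \<comment> \<open>The factor \<open>?y\<close> grows at most like
      \<open>4 / (1 - ?b\<^sup>2) powr p\<close>, again by \<open>p \<ge> 1\<close>, and this is the
      denominator in the estimate for \<open>l'\<close> alone.\<close>
    have y: "cmod ?y * ?V' \<le> 4 * \<mu>"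
    proof -
      have w: "0 < 1 - ?b\<^sup>2" "1 - ?b\<^sup>2 \<le> 1" by (rule polydisk_one_minus_sq[OF \<phi>z])+
      have "cmod ?y \<le> real (Suc N) * ?b ^ N"
        using a1 by (simp add: norm_mult norm_power mult_left_le del: of_nat_Suc)
      also have "\<dots> \<le> 4 / (1 - ?b\<^sup>2)"
        using G_bound[OF \<phi>z, of N] w by (simp add: pos_le_divide_eq del: of_nat_Suc)
      also have "\<dots> \<le> 4 / (1 - ?b\<^sup>2) powr p"
        using w p powr_mono'[of 1 p "1 - ?b\<^sup>2"] by (intro divide_left_mono) auto
      finally have "cmod ?y * ?V' \<le> 4 / (1 - ?b\<^sup>2) powr p * ?V'"
        by (rule mult_right_mono) (rule bloch_seminorm_at_nonneg)
      also have "\<dots> = 4 * (?V' / (1 - ?b\<^sup>2) powr p)" by simp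
      also have "\<dots> \<le> 4 * \<mu>" using \<delta>2(2)[OF z b_near(2)] by simp
      finally show ?thesis .
    qed
    have "cmod ?x * ?V \<le> bloch_seminorm_at q (\<lambda>z. ?G N (\<phi> z)) z + cmod ?y * ?V'"
      unfolding bloch_seminorm_at_def sum_distrib_left sum.distrib[symmetric]
    proof (rule sum_mono)
      fix k
      let ?u = "cpartial k (\<lambda>w. \<phi> w $ l) z" and ?v = "cpartial k (\<lambda>w. \<phi> w $ l') z"
      let ?w = "(1 - (cmod (z $ k))\<^sup>2) powr q"
      have "cpartial k (\<lambda>z. ?G N (\<phi> z)) z = (\<Sum>m\<in>UNIV. cpartial m (?G N) (\<phi> z) * cpartial k (\<lambda>w. \<phi> w $ m) z)"
        by (rule cpartial_eqI[OF holomorphic_cn_compose_has_derivative[OF G(2)[of N polydisk] \<phi> im z]])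
      also have "\<dots> = (\<Sum>m\<in>UNIV. (if m = l then ?x * ?u else 0) + (if m = l' then ?y * ?v else 0))"
        using False by (intro sum.cong) (auto simp: G(3) simp del: power_Suc of_nat_Suc)
      also have "\<dots> = ?x * ?u + ?y * ?v" by (simp only: sum.distrib sum.delta finite UNIV_I if_True)
      finally have eq: "cpartial k (\<lambda>z. ?G N (\<phi> z)) z = ?x * ?u + ?y * ?v" .
      have "cmod ?x * cmod ?u \<le> cmod (?x * ?u + ?y * ?v) + cmod ?y * cmod ?v"
        using norm_triangle_ineq4[of "?x * ?u + ?y * ?v" "?y * ?v"] by (simp only: norm_mult add_diff_cancel_right')
      then have "cmod ?x * cmod ?u * ?w \<le> (cmod (?x * ?u + ?y * ?v) + cmod ?y * cmod ?v) * ?w"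
        by (rule mult_right_mono) simp
      then show "cmod ?x * (cmod ?u * ?w) \<le> cmod (cpartial k (\<lambda>z. ?G N (\<phi> z)) z) * ?w + cmod ?y * (cmod ?v * ?w)"
        unfolding eq distrib_right by (simp only: mult.assoc)
    qed
    also have "\<dots> < \<mu> + 4 * \<mu>" using N0[OF \<open>N0 \<le> N\<close> z] y by linarith
    finally have xV: "cmod ?x * ?V < 5 * \<mu>" by simp
    \<comment> \<open>The lower bound covers \<open>N\<close> factors; the additional one in
      \<open>?x\<close> costs at most \<open>1 / 2\<close>.\<close>
    have "exp (- 2) * (1 / 2) \<le> ?b ^ N * ?b" by (intro mult_mono N(2) b2) auto
    then have "exp (- 2) / 2 * ?V \<le> cmod ?x * ?V"
      by (intro mult_right_mono bloch_seminorm_at_nonneg) (simp add: norm_mult norm_power mult.commute)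
    moreover have "5 * \<mu> = exp (- 2) / 2 * (\<epsilon> * d powr p)" by (simp add: \<mu>_def)
    ultimately have "exp (- 2) / 2 * ?V < exp (- 2) / 2 * (\<epsilon> * d powr p)"
      using xV by linarith
    then have V: "?V < \<epsilon> * d powr p" by (rule mult_left_less_imp_less) simp
    have "?a \<le> 1 - d" using far d by linarith
    then have "?a * ?a \<le> (1 - d) * 1" using a1 d(2) by (intro mult_mono) auto
    then have "d \<le> 1 - ?a\<^sup>2" by (simp add: power2_eq_square)
    then have "d powr p \<le> (1 - ?a\<^sup>2) powr p" using d p by (intro powr_mono2) auto
    then have "\<epsilon> * d powr p \<le> \<epsilon> * (1 - ?a\<^sup>2) powr p" using \<epsilon> by (intro mult_left_mono) auto
    with V have "?V < \<epsilon> * (1 - ?a\<^sup>2) powr p" by linarith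
    moreover have "0 < (1 - ?a\<^sup>2) powr p" using polydisk_one_minus_sq(1)[OF \<phi>z, of l] by simp
    ultimately show ?thesis by (simp add: pos_divide_less_eq)
  qed
  moreover have "0 < \<delta>" using \<delta>2 by (simp add: \<delta>_def)
  ultimately show ?thesis by blast
qed

text \<open>Near the boundary some coordinate \<open>l'\<close> is near the circle, but it varies
  with \<open>z\<close>; hence the minimum of the finitely many thresholds over all pairs.\<close>

lemma compact_imp_vanishes:
  fixes \<phi> :: "complex ^ 'n \<Rightarrow> complex ^ 'n"
  assumes comp: "compact_operator (little_bloch p) (bloch_dist p) (bloch q) (bloch_dist q) (composition_op \<phi>)"
    and \<phi>: "\<And>l. holomorphic_cn (\<lambda>z. \<phi> z $ l) polydisk"
    and im: "\<phi> ` polydisk \<subseteq> polydisk" and p: "1 \<le> p" and q: "0 \<le> q"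
  shows "vanishes_at_image_boundary \<phi> (comp_weight_sum p q \<phi>)"
  unfolding vanishes_at_image_boundary_def
proof (intro allI impI)
  fix \<epsilon> :: real assume \<epsilon>: "0 < \<epsilon>"
  define e where "e = \<epsilon> / CARD('n)"
  have e: "0 < e" using \<epsilon> by (simp add: e_def)
  have "\<forall>l l'. \<exists>\<delta>>0. \<forall>z\<in>polydisk. 1 - \<delta> < cmod (\<phi> z $ l') \<longrightarrow>
      bloch_seminorm_at q (\<lambda>w. \<phi> w $ l) z / (1 - (cmod (\<phi> z $ l))\<^sup>2) powr p < e"
    using compact_imp_weight_vanishes[OF comp \<phi> im p q e] by blast
  then obtain D where D: "\<And>l l'. 0 < D l l'" "\<And>l l' z. z \<in> polydisk \<Longrightarrow> 1 - D l l' < cmod (\<phi> z $ l') \<Longrightarrow>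
      bloch_seminorm_at q (\<lambda>w. \<phi> w $ l) z / (1 - (cmod (\<phi> z $ l))\<^sup>2) powr p < e"
    by metis
  let ?\<delta> = "Min (range (\<lambda>(l, l'). D l l'))"
  have "0 < ?\<delta>" using D(1) by (subst Min_gr_iff) auto
  moreover have "\<bar>comp_weight_sum p q \<phi> z\<bar> < \<epsilon>"
    if z: "z \<in> polydisk" and near: "infdist (\<phi> z) (frontier polydisk) < ?\<delta>" for z
  proof -
    obtain l' where l': "1 - ?\<delta> < cmod (\<phi> z $ l')" by (rule infdist_frontier_polydiskE[OF near])
    have "?\<delta> \<le> D l l'" for l by (rule Min_le) (auto intro: rev_image_eqI[of "(l, l')"])
    then have "1 - D l l' < cmod (\<phi> z $ l')" for l using l' by (smt (verit))
    then have "comp_weight_sum p q \<phi> z < (\<Sum>l\<in>(UNIV :: 'n set). e)"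
      unfolding comp_weight_sum_eq by (intro sum_strict_mono D(2)[OF z]) auto
    then show ?thesis using comp_weight_sum_nonneg[of p q \<phi> z] by (simp add: e_def)
  qed
  ultimately show "\<exists>\<delta>>0. \<forall>z\<in>polydisk. infdist (\<phi> z) (frontier polydisk) < \<delta> \<longrightarrow>
      \<bar>comp_weight_sum p q \<phi> z\<bar> < \<epsilon>" by blast
qed

section \<open>The components of the map and the bound on the weight sum\<close>

lemma compact_imp_component_in_bloch:
  fixes \<phi> :: "complex ^ 'n \<Rightarrow> complex ^ 'n"
  assumes comp: "compact_operator (little_bloch p) (bloch_dist p) (bloch q) (bloch_dist q) (composition_op \<phi>)"
    and im: "\<phi> ` polydisk \<subseteq> polydisk" and p: "0 \<le> p"
  shows "restrict (\<lambda>z. \<phi> z $ l) polydisk \<in> bloch q"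
proof -
  \<comment> \<open>The component is the image of a coordinate function, a polynomial, written in
    the form of the test polynomials.\<close>
  let ?f = "\<lambda>z :: complex ^ 'n. 1 * (z $ l) ^ Suc 0"
  have "restrict ?f polydisk \<in> bloch p"
  proof (rule restrict_in_bloch[OF coordinate_power(2)])
    fix z :: "complex ^ 'n" assume z: "z \<in> polydisk"
    have "(1 - (cmod (z $ k))\<^sup>2) powr p \<le> 1" for k
      by (rule powr_le1) (use polydisk_one_minus_sq[OF z, of k] p in linarith)+
    then show "bloch_seminorm_at p ?f z \<le> (\<Sum>k\<in>(UNIV :: 'n set). 1)"
      unfolding bloch_seminorm_at_def coordinate_power(3) by (intro sum_mono) auto
  qed
  then have "restrict ?f polydisk \<in> little_bloch p"
    by (rule polynomial_in_little_bloch[OF coordinate_power(1)])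
  then have "composition_op \<phi> (restrict ?f polydisk) \<in> bloch q"
    using comp unfolding compact_operator_def by blast
  moreover have "composition_op \<phi> (restrict ?f polydisk) = restrict (\<lambda>z. \<phi> z $ l) polydisk"
    using im by (auto simp: composition_op_def compose_def fun_eq_iff)
  ultimately show ?thesis by simp
qed

text \<open>Near the boundary the limit condition with tolerance 1 bounds the weight sum. Elsewhere
  the denominators are bounded below and the numerators are bounded by the norms of the
  components.\<close>

lemma comp_weight_sum_bounded:
  fixes \<phi> :: "complex ^ 'n \<Rightarrow> complex ^ 'n"
  assumes \<phi>: "\<And>l. holomorphic_cn (\<lambda>z. \<phi> z $ l) polydisk"
    and im: "\<phi> ` polydisk \<subseteq> polydisk" and p: "0 \<le> p"
    and in_bloch: "\<And>l. restrict (\<lambda>z. \<phi> z $ l) polydisk \<in> bloch q"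
    and van: "vanishes_at_image_boundary \<phi> (comp_weight_sum p q \<phi>)"
  shows "\<exists>M\<ge>0. \<forall>z\<in>polydisk. comp_weight_sum p q \<phi> z \<le> M"
proof -
  obtain \<delta> where \<delta>: "0 < \<delta>" and near: "\<And>z. z \<in> polydisk \<Longrightarrow>
      infdist (\<phi> z) (frontier polydisk) < \<delta> \<Longrightarrow> \<bar>comp_weight_sum p q \<phi> z\<bar> < 1"
    using van unfolding vanishes_at_image_boundary_def by (meson zero_less_one)
  \<comment> \<open>Capping at 1 keeps \<open>1 - d\<close> nonnegative when moduli are
    squared.\<close>
  define d where "d = min \<delta> 1"
  have d: "0 < d" "d \<le> 1" "d \<le> \<delta>" using \<delta> by (auto simp: d_def)
  let ?A = "\<lambda>l. bloch_norm q (restrict (\<lambda>z. \<phi> z $ l) polydisk)"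
  have A: "bloch_seminorm_at q (\<lambda>w. \<phi> w $ l) z \<le> ?A l" if z: "z \<in> polydisk" for z l
    using bloch_norm_ge(2)[OF blochD(2)[OF in_bloch] z, of l]
      bloch_seminorm_at_transform[OF \<phi>[of l], of "restrict (\<lambda>z. \<phi> z $ l) polydisk" z q] z by simp
  let ?M = "max 1 (\<Sum>l\<in>UNIV. ?A l / d powr p)"
  have "comp_weight_sum p q \<phi> z \<le> ?M" if z: "z \<in> polydisk" for z
  proof (cases "infdist (\<phi> z) (frontier polydisk) < \<delta>")
    case True
    with near[OF z] have "comp_weight_sum p q \<phi> z \<le> 1" by (simp add: abs_less_iff)
    then show ?thesis by (rule max.coboundedI1)
  next
    case False
    have \<phi>z: "\<phi> z \<in> polydisk" using im z by blast
    have "comp_weight_sum p q \<phi> z \<le> (\<Sum>l\<in>UNIV. ?A l / d powr p)"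
      unfolding comp_weight_sum_eq
    proof (rule sum_mono)
      fix l
      let ?a = "cmod (\<phi> z $ l)"
      have "?a \<le> 1 - \<delta>" using infdist_frontier_polydisk_less[OF \<phi>z _ \<delta>, of l] False by (meson not_le)
      then have "?a \<le> 1 - d" "?a \<le> 1" using d by linarith+
      then have "?a * ?a \<le> (1 - d) * 1" using d(2) by (intro mult_mono) auto
      then have "d \<le> 1 - ?a\<^sup>2" by (simp add: power2_eq_square)
      then have "d powr p \<le> (1 - ?a\<^sup>2) powr p" using d p by (intro powr_mono2) auto
      then show "bloch_seminorm_at q (\<lambda>w. \<phi> w $ l) z / (1 - ?a\<^sup>2) powr p \<le> ?A l / d powr p"
        using A[OF z, of l] bloch_seminorm_at_nonneg[of q "\<lambda>w. \<phi> w $ l" z] d(1)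
        by (intro frac_le) auto
    qed
    then show ?thesis by simp
  qed
  then show ?thesis by (intro exI[of _ ?M]) auto
qed

theorem corollary3p5:
  fixes \<phi> :: "complex ^ 'n \<Rightarrow> complex ^ 'n" and p q :: real
  assumes "\<forall>l. holomorphic_cn (\<lambda>z. \<phi> z $ l) polydisk"
    and "\<phi> ` polydisk \<subseteq> polydisk"
    and "p \<ge> 1" and "q > 0"
  shows
    "((compact_operator (bloch p) (bloch_dist p) (bloch q) (bloch_dist q) (composition_op \<phi>) \<or>
       compact_operator (little_bloch p) (bloch_dist p) (bloch q) (bloch_dist q) (composition_op \<phi>))
      \<longleftrightarrow>
      (vanishes_at_image_boundary \<phi> (comp_weight_sum p q \<phi>) \<and>
       (\<exists>M\<ge>0. \<forall>z\<in>polydisk. comp_weight_sum p q \<phi> z \<le> M)))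
     \<and>
     ((vanishes_at_image_boundary \<phi> (comp_weight_sum p q \<phi>) \<and>
       (\<exists>M\<ge>0. \<forall>z\<in>polydisk. comp_weight_sum p q \<phi> z \<le> M))
      \<longleftrightarrow>
      ((\<forall>l. restrict (\<lambda>z. \<phi> z $ l) polydisk \<in> bloch q) \<and>
       vanishes_at_image_boundary \<phi> (comp_weight_sum p q \<phi>)))"
    (is "(?big \<or> ?little \<longleftrightarrow> ?van \<and> ?bdd) \<and> (?van \<and> ?bdd \<longleftrightarrow> ?comps \<and> ?van)")
proof -
  have \<phi>: "\<And>l. holomorphic_cn (\<lambda>z. \<phi> z $ l) polydisk" using assms(1) by blast
  note im = assms(2)
  have p: "0 \<le> p" and q: "0 \<le> q" using assms(3,4) by auto
  \<comment> \<open>The scheme: either alternative gives \<open>?little\<close>, then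
    \<open>?comps\<close> and \<open>?van\<close>, then \<open>?bdd\<close>, which with
    \<open>?van\<close> returns to \<open>?big\<close>. That \<open>?bdd\<close> alone gives
    \<open>?comps\<close> closes the second equivalence.\<close>
  have "?little" if "?big \<or> ?little"
    using that compact_operator_little_bloch by blast
  moreover have "?comps \<and> ?van" if ?little
    using compact_imp_component_in_bloch[OF that im p] compact_imp_vanishes[OF that \<phi> im assms(3) q] by blast
  moreover have ?bdd if "?comps \<and> ?van"
    using that by (intro comp_weight_sum_bounded[OF \<phi> im p]) auto
  moreover have ?big if "?van \<and> ?bdd"
  proof -
    from that obtain M where "\<And>z. z \<in> polydisk \<Longrightarrow> comp_weight_sum p q \<phi> z \<le> M" by blast
    then show ?thesis using that by (intro composition_op_compact[OF \<phi> im p]) auto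
  qed
  moreover have ?comps if bdd: ?bdd
  proof
    fix l
    obtain M where M: "\<And>z. z \<in> polydisk \<Longrightarrow> comp_weight_sum p q \<phi> z \<le> M" using bdd by blast
    show "restrict (\<lambda>z. \<phi> z $ l) polydisk \<in> bloch q"
    proof (rule restrict_in_bloch[OF \<phi>])
      fix z :: "complex ^ 'n" assume z: "z \<in> polydisk"
      \<comment> \<open>The denominators are at most 1, so each seminorm is at most its quotient in
        the weight sum.\<close>
      note bloch_seminorm_le_weight[OF im z p, of q l]
      also have "bloch_seminorm_at q (\<lambda>w. \<phi> w $ l) z / (1 - (cmod (\<phi> z $ l))\<^sup>2) powr p \<le> comp_weight_sum p q \<phi> z"
        unfolding comp_weight_sum_eq
        by (rule member_le_sum[where f = "\<lambda>l. bloch_seminorm_at q (\<lambda>w. \<phi> w $ l) z / (1 - (cmod (\<phi> z $ l))\<^sup>2) powr p"])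
           (auto intro: divide_nonneg_nonneg bloch_seminorm_at_nonneg)
      also note M[OF z]
      finally show "bloch_seminorm_at q (\<lambda>w. \<phi> w $ l) z \<le> M" .
    qed
  qed
  ultimately show ?thesis by blast
qed

end
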